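(* Let $f:\mathbb{R}^d\to\mathbb{R}$ be continuously differentiable, bounded from below with $f^*:=\inf_{x\in\mathbb{R}^d}f(x)\in\mathbb{R}$, and $L$-smooth, i.e. $\|\nabla f(x)-\nabla f(y)\|\le L\|x-y\|$ for all $x,y\in\mathbb{R}^d$. Let $\nabla f(x;\xi)$ be an unbiased stochastic gradient of $f$ such that, for some constants $A,B,C\ge 0$, $$\mathbb{E}\big[\|\nabla f(x;\xi)\|^2\big]\le A(f(x)-f^* )+B\|\nabla f(x)\|^2+C\qquad\text{for all }x\in\mathbb{R}^d .$$ Let $\beta\in[0,1)$ and let the step sizes $\{\alpha_t\}$ be a sequence of positive real numbers satisfying $$\sum_{t=1}^\infty\alpha_t=\infty,\qquad \sum_{t=1}^\infty\alpha_t^2<\infty .$$ Let $\{x_t\}$ be generated, with $g_t=\nabla f(x_t;\xi_t)$, either by the stochastic heavy-ball method (SHB) $$x_{t+1}=x_t-\alpha_tg_t+\beta(x_t-x_{t-1}),\qquad t\ge1,$$ or by the stochastic Nesterov's accelerated gradient method (SNAG) $$y_{t+1}=x_t-\alpha_tg_t,\qquad x_{t+1}=y_{t+1}+\beta(y_{t+1}-y_t),\qquad t\ge1.$$ Then, in both cases, $\nabla f(x_t)\to0$ almost surely as $t\to\infty$.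
   Context: $\|\cdot\|$ is the Euclidean norm. $\xi$ is a random element and $\nabla f(x;\xi)$ (jointly measurable in $(x,\xi)$) is a stochastic gradient: it is unbiased, $\mathbb{E}[\nabla f(x;\xi)]=\nabla f(x)$ for every fixed $x\in\mathbb{R}^d$ (it is not required to be the gradient of anything). The samples $\xi_1,\xi_2,\dots$ are i.i.d. copies of $\xi$, and the initial points ($x_0,x_1\in\mathbb{R}^d$ for SHB; $x_1,y_1\in\mathbb{R}^d$ for SNAG) are arbitrary and deterministic; thus $\xi_t$ is independent of all iterates up to $x_t$. The step sizes and $\beta$ are deterministic. *)

theory Defs
  imports "HOL-Probability.Probability"
begin

definition iid_copies ::
    "'w measure \<Rightarrow> 's measure \<Rightarrow> ('w \<Rightarrow> 's) \<Rightarrow> nat set \<Rightarrow> (nat \<Rightarrow> 'w \<Rightarrow> 's) \<Rightarrow> bool" where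
  "iid_copies M S X I Xs \<longleftrightarrow>
     prob_space.indep_vars M (\<lambda>_. S) Xs I \<and> (\<forall>t\<in>I. distr M S (Xs t) = distr M S X)"

text \<open>The measure \<open>S\<close> only serves as the measurable space in which \<open>\<xi>\<close> takes its values.
  Integrability is part of unbiasedness: the Bochner integral of a non-integrable function
  is \<open>0\<close>, so the equation alone would not say that the expectation exists.\<close>

definition unbiased_stochastic_gradient ::
    "'w measure \<Rightarrow> 's measure \<Rightarrow> ('w \<Rightarrow> 's) \<Rightarrow> ('v :: euclidean_space \<Rightarrow> 's \<Rightarrow> 'v) \<Rightarrow> ('v \<Rightarrow> 'v) \<Rightarrow> bool"
  where
  "unbiased_stochastic_gradient M S \<xi> G gradf \<longleftrightarrow>
     \<xi> \<in> measurable M S \<and>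
     (\<lambda>(x, s). G x s) \<in> borel_measurable (borel \<Otimes>\<^sub>M S) \<and>
     (\<forall>x. integrable M (\<lambda>\<omega>. G x (\<xi> \<omega>)) \<and> (\<integral>\<omega>. G x (\<xi> \<omega>) \<partial>M) = gradf x)"

text \<open>In the next two definitions the values \<open>\<alpha> 0\<close>, \<open>\<xi> 0\<close> and (for SNAG) \<open>x 0\<close>, \<open>y 0\<close>
  are irrelevant; the constant initial points express that they are deterministic.\<close>

definition SHB ::
    "'w measure \<Rightarrow> ('v :: real_vector \<Rightarrow> 's \<Rightarrow> 'v) \<Rightarrow> (nat \<Rightarrow> 'w \<Rightarrow> 's) \<Rightarrow> (nat \<Rightarrow> real) \<Rightarrow> real
     \<Rightarrow> 'v \<Rightarrow> 'v \<Rightarrow> (nat \<Rightarrow> 'w \<Rightarrow> 'v) \<Rightarrow> bool" where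
  "SHB M G \<xi> \<alpha> \<beta> a\<^sub>0 a\<^sub>1 x \<longleftrightarrow>
     (\<forall>\<omega>\<in>space M. x 0 \<omega> = a\<^sub>0 \<and> x 1 \<omega> = a\<^sub>1 \<and>
       (\<forall>t\<ge>1. x (t + 1) \<omega> =
          x t \<omega> - \<alpha> t *\<^sub>R G (x t \<omega>) (\<xi> t \<omega>) + \<beta> *\<^sub>R (x t \<omega> - x (t - 1) \<omega>)))"

definition SNAG ::
    "'w measure \<Rightarrow> ('v :: real_vector \<Rightarrow> 's \<Rightarrow> 'v) \<Rightarrow> (nat \<Rightarrow> 'w \<Rightarrow> 's) \<Rightarrow> (nat \<Rightarrow> real) \<Rightarrow> real
     \<Rightarrow> 'v \<Rightarrow> 'v \<Rightarrow> (nat \<Rightarrow> 'w \<Rightarrow> 'v) \<Rightarrow> (nat \<Rightarrow> 'w \<Rightarrow> 'v) \<Rightarrow> bool" where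
  "SNAG M G \<xi> \<alpha> \<beta> a\<^sub>1 b\<^sub>1 x y \<longleftrightarrow>
     (\<forall>\<omega>\<in>space M. x 1 \<omega> = a\<^sub>1 \<and> y 1 \<omega> = b\<^sub>1 \<and>
       (\<forall>t\<ge>1. y (t + 1) \<omega> = x t \<omega> - \<alpha> t *\<^sub>R G (x t \<omega>) (\<xi> t \<omega>) \<and>
              x (t + 1) \<omega> = y (t + 1) \<omega> + \<beta> *\<^sub>R (y (t + 1) \<omega> - y t \<omega>)))"

end

theory Submission
  imports Defs
begin

text \<open>In terms of \<open>z\<^sub>t = x\<^sub>t + \<beta> / (1 - \<beta>) (x\<^sub>t - x\<^sub>t\<^sub>-\<^sub>1)\<close> for SHB and
  \<open>z\<^sub>t = (x\<^sub>t - \<beta> y\<^sub>t) / (1 - \<beta>)\<close> for SNAG, both methods read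
  \<open>z\<^sub>t\<^sub>+\<^sub>1 = z\<^sub>t - \<alpha>\<^sub>t / (1 - \<beta>) g\<^sub>t\<close>, where the offset \<open>u\<^sub>t = x\<^sub>t - z\<^sub>t\<close> satisfies
  \<open>u\<^sub>t\<^sub>+\<^sub>1 = \<beta> u\<^sub>t + \<kappa> \<alpha>\<^sub>t g\<^sub>t\<close>. Taking expectations in the descent inequality for
  \<open>f(z\<^sub>t) - f\<^sup>* + K |u\<^sub>t|\<^sup>2\<close> with \<open>K\<close> large gives \<open>\<Sum> \<alpha>\<^sub>t E|\<nabla>f(x\<^sub>t)|\<^sup>2 < \<infinity>\<close>,
  \<open>\<Sum> E|u\<^sub>t|\<^sup>2 < \<infinity>\<close> and \<open>sup E|g\<^sub>t|\<^sup>2 < \<infinity>\<close>; no supermartingale convergence theorem is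
  needed. Hence almost surely \<open>\<Sum> \<alpha>\<^sub>t |\<nabla>f(x\<^sub>t)|\<^sup>2 < \<infinity>\<close>, \<open>u\<^sub>t \<rightarrow> 0\<close>, and the martingale
  \<open>\<Sum> \<alpha>\<^sub>t (g\<^sub>t - \<nabla>f(x\<^sub>t))\<close> converges. On such a path \<open>|\<nabla>f(x\<^sub>t)|\<close> comes arbitrarily close
  to \<open>0\<close> because \<open>\<Sum> \<alpha>\<^sub>t = \<infinity>\<close>, and by Lipschitz continuity it cannot afterwards climb from
  \<open>\<epsilon>\<close> to \<open>2\<epsilon>\<close> without using up a fixed amount of \<open>\<Sum> \<alpha>\<^sub>t |\<nabla>f(x\<^sub>t)|\<^sup>2\<close>.\<close>

section \<open>Independent samples and the past\<close>

locale iid_samples = prob_space M for M :: "'w measure" +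
  fixes S :: "'s measure" and \<xi> :: "'w \<Rightarrow> 's" and X :: "nat \<Rightarrow> 'w \<Rightarrow> 's"
  assumes sample_measurable [measurable]: "\<xi> \<in> measurable M S"
    and iid: "iid_copies M S \<xi> {1..} X"
begin

text \<open>The step from time \<open>n\<close> to time \<open>Suc n\<close> consumes the sample \<open>X (Suc n)\<close>.\<close>

definition past :: "nat \<Rightarrow> 'w measure" where
  "past n = vimage_algebra (space M) (\<lambda>\<omega>. \<lambda>i\<in>{1..n}. X i \<omega>) (PiM {1..n} (\<lambda>_. S))"

lemma space_past [simp]: "space (past n) = space M"
  by (simp add: past_def)

lemma indep: "indep_vars (\<lambda>_. S) X {1..}"
  using iid by (simp add: iid_copies_def)

lemma measurable_sample: "1 \<le> i \<Longrightarrow> X i \<in> measurable M S"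
  using indep by (auto simp: indep_vars_def)

lemma measurable_history: "(\<lambda>\<omega>. \<lambda>i\<in>{1..n}. X i \<omega>) \<in> measurable M (PiM {1..n} (\<lambda>_. S))"
  by (intro measurable_restrict measurable_sample) auto

lemma measurable_history_past:
  "(\<lambda>\<omega>. \<lambda>i\<in>{1..n}. X i \<omega>) \<in> measurable (past n) (PiM {1..n} (\<lambda>_. S))"
  unfolding past_def
  by (intro measurable_vimage_algebra1) (use measurable_space[OF measurable_history] in blast)

lemma measurable_sample_past: "i \<in> {1..n} \<Longrightarrow> X i \<in> measurable (past n) S"
  using measurable_compose[OF measurable_history_past measurable_component_singleton[of i "{1..n}"]]
  by simp

lemma sets_past_subset: "sets (past n) \<subseteq> sets M"
  unfolding past_def
  by (rule sets_image_in_sets[OF refl measurable_history])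

lemma measurable_past_M: "h \<in> measurable (past n) N \<Longrightarrow> h \<in> measurable M N"
  by (erule measurable_mono[THEN subsetD, rotated -1]) (auto intro: sets_past_subset[THEN subsetD])

lemma measurable_past_mono:
  assumes "n \<le> m" "h \<in> measurable (past n) N"
  shows "h \<in> measurable (past m) N"
proof -
  have "(\<lambda>\<omega>. \<lambda>i\<in>{1..n}. X i \<omega>) \<in> measurable (past m) (PiM {1..n} (\<lambda>_. S))"
    using assms(1) by (intro measurable_restrict measurable_sample_past) auto
  then have "sets (past n) \<subseteq> sets (past m)"
    unfolding past_def[of n] by (intro sets_image_in_sets) simp_all
  then show ?thesis
    by (intro measurable_mono[THEN subsetD, OF _ _ _ _ assms(2)]) auto
qed

section \<open>Joint law of the past and the next sample\<close>

lemma measurable_ident_past: "(\<lambda>\<omega>. \<omega>) \<in> measurable M (past n)"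
  by (rule measurable_past_M[OF measurable_ident_sets[OF refl]])

text \<open>Events of the past are preimages under the tuple of the first \<open>n\<close> samples,
  and tuples over the disjoint index blocks \<open>{1..n}\<close> and \<open>{Suc n}\<close> are
  independent.\<close>

lemma prob_past_sample:
  assumes "E \<in> sets (past n)" "T \<in> sets S"
  shows "prob (E \<inter> (X (Suc n) -` T \<inter> space M)) = prob E * prob (X (Suc n) -` T \<inter> space M)"
proof -
  let ?H = "\<lambda>\<omega>. \<lambda>i\<in>{1..n}. X i \<omega>" and ?X = "\<lambda>\<omega>. \<lambda>i\<in>{Suc n}. X i \<omega>"
  let ?T = "(\<lambda>p. p (Suc n)) -` T \<inter> space (PiM {Suc n} (\<lambda>_. S))"
  obtain E' where E': "E' \<in> sets (PiM {1..n} (\<lambda>_. S))" "E = ?H -` E' \<inter> space M"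
    using assms(1) unfolding past_def
    by (subst (asm) sets_vimage_algebra2)
      (use measurable_space[OF measurable_history] in auto)
  have "?T \<in> sets (PiM {Suc n} (\<lambda>_. S))"
    using assms(2) by measurable
  then have "prob ((\<lambda>\<omega>. (?H \<omega>, ?X \<omega>)) -` (E' \<times> ?T) \<inter> space M) =
      prob (?H -` E' \<inter> space M) * prob (?X -` ?T \<inter> space M)"
    by (intro indep_varD[OF indep_var_restrict[OF indep]] E') auto
  moreover have "?X -` ?T \<inter> space M = X (Suc n) -` T \<inter> space M"
    using measurable_space[OF measurable_sample[of "Suc n"]] by (auto simp: space_PiM)
  moreover have "(\<lambda>\<omega>. (?H \<omega>, ?X \<omega>)) -` (E' \<times> ?T) \<inter> space M =
      (?H -` E' \<inter> space M) \<inter> (?X -` ?T \<inter> space M)"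
    by auto
  ultimately show ?thesis
    by (simp add: E'(2))
qed

lemma measurable_past_sample:
  "(\<lambda>\<omega>. (\<omega>, X (Suc n) \<omega>)) \<in> measurable M (past n \<Otimes>\<^sub>M S)"
  by (intro measurable_Pair measurable_sample measurable_ident_past) simp

lemma pair_prob_past_sample: "pair_prob_space (distr M (past n) (\<lambda>\<omega>. \<omega>)) (distr M S \<xi>)"
proof -
  interpret P: prob_space "distr M (past n) (\<lambda>\<omega>. \<omega>)"
    by (intro prob_space_distr measurable_ident_past)
  interpret Q: prob_space "distr M S \<xi>"
    by (intro prob_space_distr) measurable
  show ?thesis ..
qed

text \<open>Rectangles determine the product law, and \<open>prob_past_sample\<close> settles them.
  The left marginal is \<open>M\<close> restricted to the past; identical distribution lets \<xi>
  supply the right one.\<close>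

lemma distr_past_sample:
  "distr M (past n \<Otimes>\<^sub>M S) (\<lambda>\<omega>. (\<omega>, X (Suc n) \<omega>)) =
     distr M (past n) (\<lambda>\<omega>. \<omega>) \<Otimes>\<^sub>M distr M S \<xi>"
proof (rule sym, rule pair_measure_eqI)
  let ?P = "distr M (past n) (\<lambda>\<omega>. \<omega>)" and ?Q = "distr M S \<xi>"
  show "sigma_finite_measure ?P" "sigma_finite_measure ?Q"
    using pair_prob_past_sample by (simp_all add: pair_prob_space_def pair_sigma_finite_def)
  have PE: "emeasure ?P E = emeasure M E" if "E \<in> sets (past n)" for E
    using that sets.sets_into_space[OF that]
    by (simp add: emeasure_distr[OF measurable_ident_past] Int_absorb2)
  have Q: "?Q = distr M S (X (Suc n))"
    using iid by (simp add: iid_copies_def)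
  fix E T assume "E \<in> sets ?P" "T \<in> sets ?Q"
  then have E: "E \<in> sets (past n)" and T: "T \<in> sets S" by auto
  have "E \<subseteq> space M" using sets.sets_into_space[OF E] by simp
  then have "(\<lambda>\<omega>. (\<omega>, X (Suc n) \<omega>)) -` (E \<times> T) \<inter> space M = E \<inter> (X (Suc n) -` T \<inter> space M)"
    and E': "(\<lambda>\<omega>. \<omega>) -` E \<inter> space M = E"
    by auto
  then show "emeasure ?P E * emeasure ?Q T =
      emeasure (distr M (past n \<Otimes>\<^sub>M S) (\<lambda>\<omega>. (\<omega>, X (Suc n) \<omega>))) (E \<times> T)"
    unfolding Q PE[OF E] using E T prob_past_sample[OF E T]
    by (simp add: emeasure_distr measurable_past_sample measurable_sample
        emeasure_eq_measure ennreal_mult'')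
qed simp

text \<open>Tonelli for the product law. This is conditional expectation in concrete form: freeze
  the past and average over a fresh copy of \<xi>.\<close>

lemma nn_integral_past_sample:
  assumes h [measurable]: "h \<in> borel_measurable (past n \<Otimes>\<^sub>M S)"
  shows "(\<integral>\<^sup>+ \<omega>. h (\<omega>, X (Suc n) \<omega>) \<partial>M) = (\<integral>\<^sup>+ \<omega>. \<integral>\<^sup>+ \<omega>'. h (\<omega>, \<xi> \<omega>') \<partial>M \<partial>M)"
proof -
  let ?P = "distr M (past n) (\<lambda>\<omega>. \<omega>)" and ?Q = "distr M S \<xi>"
  interpret pair_prob_space ?P ?Q by (rule pair_prob_past_sample)
  have h': "h \<in> borel_measurable (?P \<Otimes>\<^sub>M ?Q)"
    by (simp cong: measurable_cong_sets)
  have id: "(\<lambda>\<omega>. \<omega>) \<in> measurable M (past n)"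
    by (rule measurable_ident_past)
  have "(\<integral>\<^sup>+ \<omega>. h (\<omega>, X (Suc n) \<omega>) \<partial>M) =
      (\<integral>\<^sup>+ p. h p \<partial>distr M (past n \<Otimes>\<^sub>M S) (\<lambda>\<omega>. (\<omega>, X (Suc n) \<omega>)))"
    by (subst nn_integral_distr[OF measurable_past_sample]) auto
  also have "\<dots> = (\<integral>\<^sup>+ \<omega>. \<integral>\<^sup>+ s. h (\<omega>, s) \<partial>?Q \<partial>?P)"
    unfolding distr_past_sample by (rule M2.nn_integral_fst[OF h', symmetric])
  also have "\<dots> = (\<integral>\<^sup>+ \<omega>. \<integral>\<^sup>+ s. h (\<omega>, s) \<partial>?Q \<partial>M)"
    using M2.borel_measurable_nn_integral_fst[OF h']
    by (subst nn_integral_distr[OF id]) (auto cong: measurable_cong_sets)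
  also have "\<dots> = (\<integral>\<^sup>+ \<omega>. \<integral>\<^sup>+ \<omega>'. h (\<omega>, \<xi> \<omega>') \<partial>M \<partial>M)"
    by (intro nn_integral_cong nn_integral_distr)  auto
  finally show ?thesis .
qed

text \<open>The signed counterpart by Fubini, for which integrability is first carried over to the
  product law.\<close>

lemma integral_past_sample:
  fixes h :: "'w \<times> 's \<Rightarrow> real"
  assumes h [measurable]: "h \<in> borel_measurable (past n \<Otimes>\<^sub>M S)"
    and int: "integrable M (\<lambda>\<omega>. h (\<omega>, X (Suc n) \<omega>))"
  shows "(\<integral>\<omega>. h (\<omega>, X (Suc n) \<omega>) \<partial>M) = (\<integral>\<omega>. \<integral>\<omega>'. h (\<omega>, \<xi> \<omega>') \<partial>M \<partial>M)"
proof -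
  let ?P = "distr M (past n) (\<lambda>\<omega>. \<omega>)" and ?Q = "distr M S \<xi>"
  interpret pair_prob_space ?P ?Q by (rule pair_prob_past_sample)
  have h': "h \<in> borel_measurable (?P \<Otimes>\<^sub>M ?Q)"
    by (simp cong: measurable_cong_sets)
  have id: "(\<lambda>\<omega>. \<omega>) \<in> measurable M (past n)"
    by (rule measurable_ident_past)
  have intd: "integrable (?P \<Otimes>\<^sub>M ?Q) h"
    unfolding distr_past_sample[symmetric]
    using int by (subst integrable_distr_eq[OF measurable_past_sample]) auto
  have "(\<integral>\<omega>. h (\<omega>, X (Suc n) \<omega>) \<partial>M) =
      (\<integral>p. h p \<partial>distr M (past n \<Otimes>\<^sub>M S) (\<lambda>\<omega>. (\<omega>, X (Suc n) \<omega>)))"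
    by (subst integral_distr[OF measurable_past_sample]) auto
  also have "\<dots> = (\<integral>\<omega>. \<integral>s. h (\<omega>, s) \<partial>?Q \<partial>?P)"
    unfolding distr_past_sample by (rule integral_fst'[OF intd, symmetric])
  also have "\<dots> = (\<integral>\<omega>. \<integral>s. h (\<omega>, s) \<partial>?Q \<partial>M)"
    using M2.borel_measurable_lebesgue_integral[of "\<lambda>\<omega> s. h (\<omega>, s)" "?P"] h'
    by (subst integral_distr[OF id]) (auto cong: measurable_cong_sets)
  also have "\<dots> = (\<integral>\<omega>. \<integral>\<omega>'. h (\<omega>, \<xi> \<omega>') \<partial>M \<partial>M)"
    by (intro Bochner_Integration.integral_cong refl integral_distr) auto
  finally show ?thesis .
qed

end

section \<open>Smooth functions bounded below\<close>

locale smooth_bounded =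
  fixes f :: "'v :: euclidean_space \<Rightarrow> real" and gradf :: "'v \<Rightarrow> 'v" and L :: real
  assumes grad: "GDERIV f x :> gradf x"
    and bdd: "bdd_below (range f)"
    and smooth: "norm (gradf x - gradf y) \<le> L * norm (x - y)"
    and L_pos: "0 < L"
begin

definition gap :: "'v \<Rightarrow> real" where
  "gap x = f x - (INF z. f z)"

lemma gap_nonneg: "0 \<le> gap x"
  unfolding gap_def using cINF_lower[OF bdd, of x] by simp

lemma borel_measurable_gap [measurable]: "gap \<in> borel_measurable borel"
proof -
  have "continuous_on UNIV f"
    using grad by (auto simp: continuous_on_eq_continuous_at gderiv_def
        intro!: has_derivative_continuous)
  then show ?thesis
    unfolding gap_def by (intro borel_measurable_diff borel_measurable_continuous_onI) auto
qed

lemma borel_measurable_grad [measurable]: "gradf \<in> borel_measurable borel"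
proof -
  have "L-lipschitz_on UNIV gradf"
    using smooth L_pos by (intro lipschitz_onI) (auto simp: dist_norm)
  then show ?thesis
    by (intro borel_measurable_continuous_onI lipschitz_on_continuous_on)
qed

text \<open>The mean value theorem costs a factor 2 against the usual constant \<open>L / 2\<close>, which is
  harmless here.\<close>

lemma gap_le: "gap y \<le> gap x + gradf x \<bullet> (y - x) + L * (norm (y - x))\<^sup>2"
proof -
  have "((\<lambda>t. f (x + t *\<^sub>R (y - x))) has_derivative
      (\<lambda>h. (h *\<^sub>R (y - x)) \<bullet> gradf (x + t *\<^sub>R (y - x)))) (at t within {0..1})" for t
    using grad[of "x + t *\<^sub>R (y - x)"] unfolding gderiv_def
    by (intro has_derivative_compose[where g = f and f = "\<lambda>t. x + t *\<^sub>R (y - x)"])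
      (auto intro!: derivative_eq_intros simp: inner_commute)
  then obtain t :: real where t: "t \<in> {0<..<1}"
    and "f (x + 1 *\<^sub>R (y - x)) - f (x + 0 *\<^sub>R (y - x)) =
      ((1 - 0) *\<^sub>R (y - x)) \<bullet> gradf (x + t *\<^sub>R (y - x))"
    using mvt_simple[of 0 1 "\<lambda>t. f (x + t *\<^sub>R (y - x))"
      "\<lambda>t h. (h *\<^sub>R (y - x)) \<bullet> gradf (x + t *\<^sub>R (y - x))"] by auto
  then have "f y - f x = gradf x \<bullet> (y - x) + (gradf (x + t *\<^sub>R (y - x)) - gradf x) \<bullet> (y - x)"
    by (simp add: inner_diff_left inner_diff_right inner_commute)
  also have "(gradf (x + t *\<^sub>R (y - x)) - gradf x) \<bullet> (y - x)
      \<le> norm (gradf (x + t *\<^sub>R (y - x)) - gradf x) * norm (y - x)"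
    by (rule norm_cauchy_schwarz)
  also have "\<dots> \<le> (L * norm (t *\<^sub>R (y - x))) * norm (y - x)"
    using smooth[of "x + t *\<^sub>R (y - x)" x] by (intro mult_right_mono) auto
  also have "\<dots> = (L * norm (y - x) * norm (y - x)) * t"
    using t by simp
  also have "\<dots> \<le> (L * norm (y - x) * norm (y - x)) * 1"
    using t L_pos by (intro mult_left_mono) auto
  finally show ?thesis
    by (simp add: gap_def power2_eq_square mult.assoc)
qed

text \<open>Take one gradient step of length \<open>1 / (2 * L)\<close>.\<close>

lemma norm_grad_le_gap: "(norm (gradf x))\<^sup>2 \<le> 4 * L * gap x"
proof -
  let ?s = "1 / (2 * L)"
  have "0 \<le> gap (x - ?s *\<^sub>R gradf x)"
    by (rule gap_nonneg)
  also have "\<dots> \<le> gap x - ?s * (norm (gradf x))\<^sup>2 + L * (?s * norm (gradf x))\<^sup>2"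
    using gap_le[of "x - ?s *\<^sub>R gradf x" x] L_pos by (simp add: power2_norm_eq_inner)
  also have "\<dots> = gap x - (norm (gradf x))\<^sup>2 / (4 * L)"
    using L_pos by (simp add: power2_eq_square field_simps)
  finally show ?thesis
    using L_pos by (simp add: field_simps)
qed

text \<open>The descent bound at \<open>z\<close>, with Young's inequality for the cross term and
  the gradient controlled by the gap. It transfers control of \<open>z\<close> and \<open>u\<close>
  to the point where gradients are sampled.\<close>

lemma gap_add_le: "gap (z + u) \<le> (1 + 2 * L) * (gap z + (norm u)\<^sup>2)"
proof -
  have "gradf z \<bullet> u \<le> ((norm (gradf z))\<^sup>2 + (norm u)\<^sup>2) / 2"
    using inner_ge_zero[of "gradf z - u"]
    by (simp add: power2_norm_eq_inner inner_diff_left inner_diff_right inner_commute)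
  then have "gap (z + u) \<le> gap z + ((norm (gradf z))\<^sup>2 + (norm u)\<^sup>2) / 2 + L * (norm u)\<^sup>2"
    using gap_le[of "z + u" z] by (simp add: field_simps)
  also have "\<dots> \<le> gap z + (4 * L * gap z + (norm u)\<^sup>2) / 2 + L * (norm u)\<^sup>2"
    using norm_grad_le_gap[of z] by simp
  also have "\<dots> \<le> (1 + 2 * L) * (gap z + (norm u)\<^sup>2)"
    using L_pos by (simp add: algebra_simps)
  finally show ?thesis .
qed

end

section \<open>Real sequences\<close>

text \<open>Discrete Gronwall: \<open>1 + p n\<close> is at most \<open>exp (p n)\<close>, and each
  \<open>q n\<close> may be multiplied by an exponential that is at least 1.\<close>

lemma exp_bound_of_linear_recursion:
  fixes a p q :: "nat \<Rightarrow> real"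
  assumes nonneg: "\<And>n. 0 \<le> a n" "\<And>n. 0 \<le> p n" "\<And>n. 0 \<le> q n"
    and step: "\<And>n. a (Suc n) \<le> (1 + p n) * a n + q n"
  shows "a n \<le> exp (\<Sum>i<n. p i) * (a 0 + (\<Sum>i<n. q i))"
proof (induction n)
  case (Suc n)
  let ?P = "\<Sum>i<n. p i" and ?Q = "a 0 + (\<Sum>i<n. q i)"
  have "1 \<le> exp (?P + p n)"
    using nonneg by (simp add: sum_nonneg add_nonneg_nonneg)
  then have "q n \<le> exp (?P + p n) * q n"
    using mult_right_mono[of 1 "exp (?P + p n)" "q n"] nonneg by simp
  moreover have "(1 + p n) * a n \<le> exp (p n) * (exp ?P * ?Q)"
    using nonneg Suc exp_ge_add_one_self by (intro mult_mono) (auto simp: add.commute)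
  ultimately show ?case
    using step[of n] by (simp add: exp_add algebra_simps)
qed simp

text \<open>A deterministic analogue of the Robbins-Siegmund argument, meant for expectations.
  Gronwall bounds \<open>a\<close>; with that bound inserted in \<open>p n * a n\<close>, the
  recursion telescopes and bounds the sums of \<open>r\<close>.\<close>

lemma summable_of_linear_recursion:
  fixes a p q r :: "nat \<Rightarrow> real"
  assumes nonneg: "\<And>n. 0 \<le> a n" "\<And>n. 0 \<le> p n" "\<And>n. 0 \<le> q n" "\<And>n. 0 \<le> r n"
    and step: "\<And>n. a (Suc n) + r n \<le> (1 + p n) * a n + q n"
    and sum: "summable p" "summable q"
  shows "\<exists>K. \<forall>n. a n \<le> K" and "summable r"
proof -
  let ?K = "exp (suminf p) * (a 0 + suminf q)"
  have P: "(\<Sum>i<n. p i) \<le> suminf p" and Q: "(\<Sum>i<n. q i) \<le> suminf q" for n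
    using nonneg sum by (auto intro!: sum_le_suminf)
  have K: "a n \<le> ?K" for n
  proof -
    have "a n \<le> exp (\<Sum>i<n. p i) * (a 0 + (\<Sum>i<n. q i))"
    proof (rule exp_bound_of_linear_recursion)
      show "a (Suc n) \<le> (1 + p n) * a n + q n" for n
        using step[of n] nonneg(4)[of n] by simp
    qed (use nonneg in auto)
    also have "\<dots> \<le> ?K"
      using P Q nonneg by (intro mult_mono) (auto intro!: add_nonneg_nonneg sum_nonneg)
    finally show ?thesis .
  qed
  then show "\<exists>K. \<forall>n. a n \<le> K" by blast
  have R: "a n + (\<Sum>i<n. r i) \<le> a 0 + ?K * (\<Sum>i<n. p i) + (\<Sum>i<n. q i)" for n
  proof (induction n)
    case (Suc n)
    have "p n * a n \<le> p n * ?K" using K nonneg by (intro mult_left_mono) auto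
    then show ?case using Suc step[of n] by (simp add: algebra_simps)
  qed simp
  have P': "?K * (\<Sum>i<n. p i) \<le> ?K * suminf p" for n
    using order_trans[OF nonneg(1) K] by (intro mult_left_mono P)
  have "(\<Sum>i<n. r i) \<le> a 0 + ?K * suminf p + suminf q" for n
    using R[of n] P'[of n] Q[of n] nonneg(1)[of n] by linarith
  then show "summable r"
    by (rule summableI_nonneg_bounded[OF nonneg(4)])
qed

text \<open>If \<open>b\<close> stayed at least \<epsilon> from \<open>m\<close> on, then
  \<open>a\<close> would be dominated by a multiple of \<open>a * b\<^sup>2\<close> and hence be
  summable.\<close>

lemma not_eventually_bounded_away:
  fixes a b :: "nat \<Rightarrow> real"
  assumes nonneg: "\<And>n. 0 \<le> a n" and "\<not> summable a" and "summable (\<lambda>n. a n * (b n)\<^sup>2)"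
    and \<epsilon>: "0 < \<epsilon>"
  shows "\<exists>n\<ge>m. b n < \<epsilon>"
proof (rule ccontr)
  assume "\<not> (\<exists>n\<ge>m. b n < \<epsilon>)"
  then have b: "\<epsilon> \<le> b n" if "m \<le> n" for n
    using that by force
  have "summable (\<lambda>n. (a n * (b n)\<^sup>2) / \<epsilon>\<^sup>2)"
    by (intro summable_divide assms)
  moreover have "norm (a n) \<le> (a n * (b n)\<^sup>2) / \<epsilon>\<^sup>2" if "m \<le> n" for n
    using mult_left_mono[OF power_mono[OF b[OF that], of 2] nonneg[of n]] \<epsilon> nonneg[of n]
    by (simp add: field_simps)
  ultimately show False
    using assms(2) summable_comparison_test'[of _ m a] by blast
qed

text \<open>The index \<open>k\<close> of the last visit below \<open>\<epsilon>\<close> starts an excursion on which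
  \<open>b \<le> b\<^sup>2 / \<epsilon>\<close>, so that the excursion is controlled by a tail of \<open>\<Sum> a b\<^sup>2\<close>.\<close>

lemma tendsto_zero_of_slow_variation:
  fixes a b :: "nat \<Rightarrow> real"
  assumes nonneg: "\<And>n. 0 \<le> a n" "\<And>n. 0 \<le> b n" "0 \<le> K"
    and a0: "a \<longlonglongrightarrow> 0" and div: "\<not> summable a" and sum: "summable (\<lambda>n. a n * (b n)\<^sup>2)"
    and vary: "\<And>\<delta>. 0 < \<delta> \<Longrightarrow> \<exists>N. \<forall>m\<ge>N. \<forall>n\<ge>m. b n \<le> b m + K * (\<Sum>i=m..<n. a i * b i) + \<delta>"
  shows "b \<longlonglongrightarrow> 0"
proof (rule LIMSEQ_I)
  fix r :: real assume "0 < r"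
  \<comment> \<open>Error budget: an excursion starts below \<epsilon> and gains at most
    \<open>\<epsilon> / 4\<close> from \<open>vary\<close> and \<open>\<epsilon> / 2\<close> from
    the weighted sum, so it stays below \<open>2 * \<epsilon> = r\<close>.\<close>
  define \<epsilon> where "\<epsilon> = r / 2"
  have \<epsilon>: "0 < \<epsilon>" using \<open>0 < r\<close> by (simp add: \<epsilon>_def)
  obtain N1 where N1: "b n \<le> b m + K * (\<Sum>i=m..<n. a i * b i) + \<epsilon> / 4" if "N1 \<le> m" "m \<le> n" for m n
    using vary[of "\<epsilon> / 4"] \<epsilon> by auto
  \<comment> \<open>Dividing by \<open>K + 1\<close> keeps the thresholds meaningful when
    \<open>K = 0\<close>.\<close>
  have pos: "0 < \<epsilon> / (4 * (K + 1))" "0 < \<epsilon>\<^sup>2 / (4 * (K + 1))"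
    using \<epsilon> nonneg(3) by auto
  obtain N2 where N2: "a n < 1 / (4 * (K + 1))" if "N2 \<le> n" for n
    using LIMSEQ_D[OF a0, of "1 / (4 * (K + 1))"] nonneg(3) by fastforce
  obtain N3 where N3: "norm (\<Sum>i=m..<n. a i * (b i)\<^sup>2) < \<epsilon>\<^sup>2 / (4 * (K + 1))" if "N3 \<le> m" for m n
    using sum pos(2) unfolding summable_Cauchy by blast
  define N where "N = max N1 (max N2 N3)"
  obtain m where m: "N \<le> m" "b m < \<epsilon>"
    using not_eventually_bounded_away[OF nonneg(1) div sum \<epsilon>] by blast
  have "b n < r" if "m \<le> n" for n
  proof -
    define k where "k = Max {k. k \<le> n \<and> b k < \<epsilon>}"
    have fin: "finite {k. k \<le> n \<and> b k < \<epsilon>}" by simp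
    have "k \<in> {k. k \<le> n \<and> b k < \<epsilon>}"
      unfolding k_def using that m by (intro Max_in fin) auto
    then have k: "k \<le> n" "b k < \<epsilon>" by auto
    have "m \<le> k"
      using that m unfolding k_def by (intro Max_ge fin) auto
    then have kN: "N1 \<le> k" "N2 \<le> k" "N3 \<le> k"
      using m(1) by (auto simp: N_def)
    have exc: "\<epsilon> \<le> b i" if "k < i" "i \<le> n" for i
      using Max_ge[OF fin, of i] that unfolding k_def[symmetric] by force
    have le: "a i * b i \<le> (if i = k then a k * \<epsilon> else 0) + a i * (b i)\<^sup>2 / \<epsilon>"
      if "i \<in> {k..<n}" for i
    proof (cases "i = k")
      case True
      have "a k * b k \<le> a k * \<epsilon>" using k nonneg by (intro mult_left_mono) auto
      moreover have "0 \<le> a k * (b k)\<^sup>2 / \<epsilon>" using \<epsilon> nonneg by simp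
      ultimately show ?thesis using True by simp
    next
      case False
      have "(a i * b i) * \<epsilon> \<le> (a i * b i) * b i"
        using exc[of i] that False nonneg by (intro mult_left_mono) auto
      then show ?thesis using \<epsilon> False by (simp add: field_simps power2_eq_square)
    qed
    have "(\<Sum>i=k..<n. a i * b i) \<le> (\<Sum>i=k..<n. (if i = k then a k * \<epsilon> else 0) + a i * (b i)\<^sup>2 / \<epsilon>)"
      by (rule sum_mono) (rule le)
    also have "\<dots> \<le> a k * \<epsilon> + (\<Sum>i=k..<n. a i * (b i)\<^sup>2) / \<epsilon>"
      using nonneg \<epsilon> by (simp add: sum.distrib sum_divide_distrib)
    also have "\<dots> \<le> 1 / (4 * (K + 1)) * \<epsilon> + \<epsilon>\<^sup>2 / (4 * (K + 1)) / \<epsilon>"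
      using N2[OF kN(2)] N3[OF kN(3), of n] \<epsilon>
      by (intro add_mono mult_right_mono divide_right_mono) auto
    also have "\<dots> = \<epsilon> / (2 * (K + 1))"
    proof -
      have "1 / (4 * J) * \<epsilon> + \<epsilon>\<^sup>2 / (4 * J) / \<epsilon> = \<epsilon> / (2 * J)" if "0 < J" for J
        using \<epsilon> that by (simp add: power2_eq_square field_simps)
      from this[of "K + 1"] show ?thesis using nonneg(3) by fastforce
    qed
    finally have "K * (\<Sum>i=k..<n. a i * b i) \<le> K * (\<epsilon> / (2 * (K + 1)))"
      using nonneg(3) by (rule mult_left_mono)
    also have "\<dots> \<le> \<epsilon> / 2"
      using \<epsilon> nonneg(3) by (simp add: field_simps)
    finally show ?thesis
      using N1[OF kN(1) k(1)] k(2) \<epsilon> by (simp add: \<epsilon>_def)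
  qed
  then show "\<exists>m. \<forall>n\<ge>m. norm (b n - 0) < r"
    using nonneg(2) by auto
qed

section \<open>Sums of centred noise\<close>

lemma integrable_inner_of_squares:
  fixes U V :: "'w \<Rightarrow> 'v :: euclidean_space"
  assumes [measurable]: "U \<in> borel_measurable M" "V \<in> borel_measurable M"
    and int: "integrable M (\<lambda>\<omega>. (norm (U \<omega>))\<^sup>2)" "integrable M (\<lambda>\<omega>. (norm (V \<omega>))\<^sup>2)"
  shows "integrable M (\<lambda>\<omega>. U \<omega> \<bullet> V \<omega>)"
proof (rule Bochner_Integration.integrable_bound[OF Bochner_Integration.integrable_add[OF int]])
  have "\<bar>U \<omega> \<bullet> V \<omega>\<bar> \<le> (norm (U \<omega>))\<^sup>2 + (norm (V \<omega>))\<^sup>2" for \<omega>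
  proof -
    have "\<bar>U \<omega> \<bullet> V \<omega>\<bar> \<le> norm (U \<omega>) * norm (V \<omega>)"
      by (rule Cauchy_Schwarz_ineq2)
    also have "\<dots> \<le> (norm (U \<omega>))\<^sup>2 + (norm (V \<omega>))\<^sup>2"
      using sum_squares_bound[of "norm (U \<omega>)" "norm (V \<omega>)"]
        mult_nonneg_nonneg[OF norm_ge_zero[of "U \<omega>"] norm_ge_zero[of "V \<omega>"]] by linarith
    finally show ?thesis .
  qed
  then show "AE \<omega> in M. norm (U \<omega> \<bullet> V \<omega>) \<le> norm ((norm (U \<omega>))\<^sup>2 + (norm (V \<omega>))\<^sup>2)"
    by simp
qed measurable

text \<open>Sum and integral commute for nonnegative terms, so the total has finite integral and is
  finite almost everywhere.\<close>

lemma AE_summable_of_summable_integral: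
  fixes r :: "nat \<Rightarrow> 'w \<Rightarrow> real"
  assumes int: "\<And>n. integrable M (r n)" and nonneg: "\<And>n \<omega>. 0 \<le> r n \<omega>"
    and sum: "summable (\<lambda>n. \<integral>\<omega>. r n \<omega> \<partial>M)"
  shows "AE \<omega> in M. summable (\<lambda>n. r n \<omega>)"
proof -
  have [measurable]: "r n \<in> borel_measurable M" for n
    using int by (rule borel_measurable_integrable)
  have "(\<integral>\<^sup>+ \<omega>. (\<Sum>n. ennreal (r n \<omega>)) \<partial>M) = (\<Sum>n. \<integral>\<^sup>+ \<omega>. ennreal (r n \<omega>) \<partial>M)"
    by (rule nn_integral_suminf) measurable
  also have "\<dots> = (\<Sum>n. ennreal (\<integral>\<omega>. r n \<omega> \<partial>M))"
    using int nonneg by (simp add: nn_integral_eq_integral)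
  also have "\<dots> = ennreal (\<Sum>n. \<integral>\<omega>. r n \<omega> \<partial>M)"
    using nonneg by (intro suminf_ennreal2 sum) (simp add: Bochner_Integration.integral_nonneg)
  finally have "(\<integral>\<^sup>+ \<omega>. (\<Sum>n. ennreal (r n \<omega>)) \<partial>M) \<noteq> \<infinity>"
    by simp
  then have "AE \<omega> in M. (\<Sum>n. ennreal (r n \<omega>)) \<noteq> \<infinity>"
    by (intro nn_integral_noteq_infinite) measurable
  then show ?thesis
    by eventually_elim (use nonneg in \<open>auto intro: summable_suminf_not_top\<close>)
qed

context iid_samples
begin

text \<open>The sum of \<open>d m, d (m + 1), \<dots>\<close> frozen once its norm reaches \<open>\<epsilon>\<close>; the second moment of
  this single variable replaces a maximal inequality.\<close>

primrec stopped_sum ::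
    "(nat \<Rightarrow> 'w \<Rightarrow> 'v :: euclidean_space) \<Rightarrow> nat \<Rightarrow> real \<Rightarrow> nat \<Rightarrow> 'w \<Rightarrow> 'v" where
  "stopped_sum d m \<epsilon> 0 = (\<lambda>\<omega>. 0)"
| "stopped_sum d m \<epsilon> (Suc k) = (\<lambda>\<omega>. stopped_sum d m \<epsilon> k \<omega> +
     (if norm (stopped_sum d m \<epsilon> k \<omega>) < \<epsilon> then d (m + k) \<omega> else 0))"

text \<open>A frozen value has norm at least \<epsilon> and never changes again, so a norm below
  \<epsilon> certifies that nothing was frozen before. Conversely, one late value detects every
  earlier excursion.\<close>

lemma stopped_sum_less:
  assumes "norm (stopped_sum d m \<epsilon> k \<omega>) < \<epsilon>"
  shows "stopped_sum d m \<epsilon> k \<omega> = (\<Sum>i<k. d (m + i) \<omega>)"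
    and "\<forall>j\<le>k. norm (\<Sum>i<j. d (m + i) \<omega>) < \<epsilon>"
proof -
  have "stopped_sum d m \<epsilon> k \<omega> = (\<Sum>i<k. d (m + i) \<omega>) \<and>
      (\<forall>j\<le>k. norm (\<Sum>i<j. d (m + i) \<omega>) < \<epsilon>)"
    using assms
  proof (induction k)
    case (Suc k)
    then have "norm (stopped_sum d m \<epsilon> k \<omega>) < \<epsilon>"
      by (auto split: if_splits)
    with Suc show ?case
      by (auto simp: le_Suc_eq)
  qed simp
  then show "stopped_sum d m \<epsilon> k \<omega> = (\<Sum>i<k. d (m + i) \<omega>)"
    and "\<forall>j\<le>k. norm (\<Sum>i<j. d (m + i) \<omega>) < \<epsilon>" by auto
qed

text \<open>\<open>centred\<close> is the martingale difference property in weak form: orthogonality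
  to square-integrable variables of the past replaces a vanishing conditional expectation.\<close>

context
  fixes d :: "nat \<Rightarrow> 'w \<Rightarrow> 'v :: euclidean_space"
  assumes adapted: "\<And>n. d n \<in> borel_measurable (past (Suc n))"
    and square_integrable: "\<And>n. integrable M (\<lambda>\<omega>. (norm (d n \<omega>))\<^sup>2)"
    and centred: "\<And>n Y. Y \<in> borel_measurable (past n) \<Longrightarrow> integrable M (\<lambda>\<omega>. (norm (Y \<omega>))\<^sup>2) \<Longrightarrow>
      (\<integral>\<omega>. Y \<omega> \<bullet> d n \<omega> \<partial>M) = 0"
begin

section \<open>Orthogonal increments, maximal inequality and almost sure convergence\<close>

lemma measurable_stopped_sum: "stopped_sum d m \<epsilon> k \<in> borel_measurable (past (m + k))"
proof (induction k)
  case (Suc k)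
  have [measurable]: "stopped_sum d m \<epsilon> k \<in> borel_measurable (past (m + Suc k))"
    "d (m + k) \<in> borel_measurable (past (m + Suc k))"
    using measurable_past_mono[OF _ Suc] adapted[of "m + k"] by auto
  show ?case unfolding stopped_sum.simps by measurable
qed simp

text \<open>The sum while unfrozen, \<open>?Y\<close>, is known before the next increment, so the
  cross term vanishes by \<open>centred\<close>; freezing only discards squares.\<close>

lemma second_moment_stopped_sum:
  "integrable M (\<lambda>\<omega>. (norm (stopped_sum d m \<epsilon> k \<omega>))\<^sup>2) \<and>
   (\<integral>\<omega>. (norm (stopped_sum d m \<epsilon> k \<omega>))\<^sup>2 \<partial>M) \<le> (\<Sum>i<k. \<integral>\<omega>. (norm (d (m + i) \<omega>))\<^sup>2 \<partial>M)"
proof (induction k)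
  case (Suc k)
  let ?T = "stopped_sum d m \<epsilon> k" and ?d = "d (m + k)"
  let ?Y = "\<lambda>\<omega>. if norm (?T \<omega>) < \<epsilon> then ?T \<omega> else 0"
  let ?r = "\<lambda>\<omega>. if norm (?T \<omega>) < \<epsilon> then (norm (?d \<omega>))\<^sup>2 else 0"
  have [measurable]: "?T \<in> borel_measurable (past (m + k))"
    by (rule measurable_stopped_sum)
  have Y: "?Y \<in> borel_measurable (past (m + k))" by measurable
  have [measurable]: "?T \<in> borel_measurable M" "?Y \<in> borel_measurable M" "?d \<in> borel_measurable M"
    using measurable_past_M[OF measurable_stopped_sum] measurable_past_M[OF Y]
      measurable_past_M[OF adapted] by auto
  have Yint: "integrable M (\<lambda>\<omega>. (norm (?Y \<omega>))\<^sup>2)"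
    by (rule Bochner_Integration.integrable_bound[OF conjunct1[OF Suc]]) auto
  have rint: "integrable M ?r"
    by (rule Bochner_Integration.integrable_bound[OF square_integrable[of "m + k"]]) auto
  have Yd: "integrable M (\<lambda>\<omega>. ?Y \<omega> \<bullet> ?d \<omega>)"
    by (intro integrable_inner_of_squares Yint square_integrable) measurable
  have eq: "(norm (stopped_sum d m \<epsilon> (Suc k) \<omega>))\<^sup>2 =
      (norm (?T \<omega>))\<^sup>2 + 2 * (?Y \<omega> \<bullet> ?d \<omega>) + ?r \<omega>" for \<omega>
    by (simp add: power2_norm_eq_inner inner_add_left inner_add_right inner_commute)
  have "integrable M (\<lambda>\<omega>. (norm (stopped_sum d m \<epsilon> (Suc k) \<omega>))\<^sup>2)"
    unfolding eq using Suc Yd rint by (intro Bochner_Integration.integrable_add) auto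
  moreover have "(\<integral>\<omega>. (norm (stopped_sum d m \<epsilon> (Suc k) \<omega>))\<^sup>2 \<partial>M) =
      (\<integral>\<omega>. (norm (?T \<omega>))\<^sup>2 \<partial>M) + 2 * (\<integral>\<omega>. ?Y \<omega> \<bullet> ?d \<omega> \<partial>M) + (\<integral>\<omega>. ?r \<omega> \<partial>M)"
    unfolding eq using conjunct1[OF Suc] Yd rint by simp
  moreover have "(\<integral>\<omega>. ?Y \<omega> \<bullet> ?d \<omega> \<partial>M) = 0"
    by (rule centred[OF Y Yint])
  moreover have "(\<integral>\<omega>. ?r \<omega> \<partial>M) \<le> (\<integral>\<omega>. (norm (?d \<omega>))\<^sup>2 \<partial>M)"
    by (rule integral_mono[OF rint square_integrable]) auto
  ultimately show ?case using Suc by simp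
qed simp

text \<open>A Kolmogorov-type maximal inequality. If some partial sum up to \<open>k\<close> reaches
  \<epsilon>, so does the stopped sum at \<open>k\<close>, and Markov applies to this one variable;
  then \<open>k\<close> tends to infinity.\<close>

lemma prob_partial_sum_ge:
  assumes "0 < \<epsilon>" and sum: "summable (\<lambda>n. \<integral>\<omega>. (norm (d n \<omega>))\<^sup>2 \<partial>M)"
  shows "prob {\<omega>\<in>space M. \<exists>j. \<epsilon> \<le> norm (\<Sum>i<j. d (m + i) \<omega>)}
    \<le> (\<Sum>i. \<integral>\<omega>. (norm (d (i + m) \<omega>))\<^sup>2 \<partial>M) / \<epsilon>\<^sup>2"
proof -
  let ?R = "\<Sum>i. \<integral>\<omega>. (norm (d (i + m) \<omega>))\<^sup>2 \<partial>M"
  have [measurable]: "d n \<in> borel_measurable M" for n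
    by (rule measurable_past_M[OF adapted])
  have [measurable]: "stopped_sum d m \<epsilon> k \<in> borel_measurable M" for k
    by (rule measurable_past_M[OF measurable_stopped_sum])
  define E where "E k = {\<omega>\<in>space M. \<exists>j\<le>k. \<epsilon> \<le> norm (\<Sum>i<j. d (m + i) \<omega>)}" for k
  have [measurable]: "E k \<in> events" for k
    unfolding E_def by measurable
  have "prob (E k) \<le> ?R / \<epsilon>\<^sup>2" for k
  proof -
    let ?T = "stopped_sum d m \<epsilon> k"
    have "E k \<subseteq> {\<omega>\<in>space M. \<epsilon>\<^sup>2 \<le> (norm (?T \<omega>))\<^sup>2}"
    proof
      fix \<omega> assume "\<omega> \<in> E k"
      then have "\<omega> \<in> space M" "\<not> norm (?T \<omega>) < \<epsilon>"
        using stopped_sum_less(2)[of d m \<epsilon> k \<omega>] by (force simp: E_def)+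
      then show "\<omega> \<in> {\<omega>\<in>space M. \<epsilon>\<^sup>2 \<le> (norm (?T \<omega>))\<^sup>2}"
        using assms(1) by (simp add: power_mono)
    qed
    then have "prob (E k) \<le> prob {\<omega>\<in>space M. \<epsilon>\<^sup>2 \<le> (norm (?T \<omega>))\<^sup>2}"
      by (intro finite_measure_mono) measurable
    also have "\<dots> \<le> (\<integral>\<omega>. (norm (?T \<omega>))\<^sup>2 \<partial>M) / \<epsilon>\<^sup>2"
      using second_moment_stopped_sum assms(1)
      by (intro integral_Markov_inequality_measure[where A = "{}"]) auto
    also have "\<dots> \<le> (\<Sum>i<k. \<integral>\<omega>. (norm (d (m + i) \<omega>))\<^sup>2 \<partial>M) / \<epsilon>\<^sup>2"
      using second_moment_stopped_sum by (intro divide_right_mono) auto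
    also have "(\<Sum>i<k. \<integral>\<omega>. (norm (d (m + i) \<omega>))\<^sup>2 \<partial>M) \<le> ?R"
      using sum_le_suminf[OF summable_ignore_initial_segment[OF sum, of m], of "{..<k}"]
      by (simp add: add.commute Bochner_Integration.integral_nonneg)
    finally show ?thesis by (simp add: divide_right_mono)
  qed
  moreover have "incseq E"
    unfolding incseq_def E_def by (blast intro: le_trans)
  then have "(\<lambda>k. prob (E k)) \<longlonglongrightarrow> prob (\<Union>k. E k)"
    by (intro finite_Lim_measure_incseq) auto
  ultimately have "prob (\<Union>k. E k) \<le> ?R / \<epsilon>\<^sup>2"
    by (intro LIMSEQ_le_const2) auto
  moreover have "(\<Union>k. E k) = {\<omega>\<in>space M. \<exists>j. \<epsilon> \<le> norm (\<Sum>i<j. d (m + i) \<omega>)}"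
    by (auto simp: E_def)
  ultimately show ?thesis by simp
qed

text \<open>The exceptional event lies in the maximal-inequality event for every starting index, and
  the bounds there are tails of a convergent series.\<close>

lemma AE_eventually_small_sums:
  assumes \<epsilon>: "0 < \<epsilon>" and sum: "summable (\<lambda>n. \<integral>\<omega>. (norm (d n \<omega>))\<^sup>2 \<partial>M)"
  shows "AE \<omega> in M. \<exists>m. \<forall>j. norm (\<Sum>i<j. d (m + i) \<omega>) < \<epsilon>"
proof -
  let ?R = "\<lambda>m. \<Sum>i. \<integral>\<omega>. (norm (d (i + m) \<omega>))\<^sup>2 \<partial>M"
  let ?N = "{\<omega>\<in>space M. \<forall>m. \<exists>j. \<epsilon> \<le> norm (\<Sum>i<j. d (m + i) \<omega>)}"
  have [measurable]: "d n \<in> borel_measurable M" for n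
    by (rule measurable_past_M[OF adapted])
  have N [measurable]: "?N \<in> events" by measurable
  have "prob ?N \<le> ?R m / \<epsilon>\<^sup>2" for m
  proof -
    have "prob ?N \<le> prob {\<omega>\<in>space M. \<exists>j. \<epsilon> \<le> norm (\<Sum>i<j. d (m + i) \<omega>)}"
      by (intro finite_measure_mono) auto
    then show ?thesis using prob_partial_sum_ge[OF assms, of m] by simp
  qed
  moreover have "(\<lambda>m. ?R m / \<epsilon>\<^sup>2) \<longlonglongrightarrow> 0 / \<epsilon>\<^sup>2"
    using \<epsilon> by (intro tendsto_divide suminf_exist_split2 sum) auto
  ultimately have "prob ?N \<le> 0"
    by (intro LIMSEQ_le_const) auto
  then have "AE \<omega> in M. \<omega> \<notin> ?N"
    using N by (intro AE_not_in) (auto simp: null_sets_def emeasure_eq_measure measure_le_0_iff)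
  then show ?thesis
    using AE_space by eventually_elim (auto simp: not_le)
qed

text \<open>Thresholds \<open>1 / real (Suc q)\<close> reduce the Cauchy criterion to countably many
  almost sure events.\<close>

lemma AE_summable_centred:
  assumes sum: "summable (\<lambda>n. \<integral>\<omega>. (norm (d n \<omega>))\<^sup>2 \<partial>M)"
  shows "AE \<omega> in M. summable (\<lambda>n. d n \<omega>)"
proof -
  have "AE \<omega> in M. \<forall>q. \<exists>m. \<forall>j. norm (\<Sum>i<j. d (m + i) \<omega>) < 1 / real (Suc q)"
    by (subst AE_all_countable) (intro allI AE_eventually_small_sums sum, simp)
  then show ?thesis
  proof eventually_elim
    case (elim \<omega>)
    show ?case unfolding summable_Cauchy
    proof (intro allI impI)
      fix e :: real assume "0 < e"
      \<comment> \<open>Half of \<open>e\<close>, since the block from \<open>m\<close> to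
        \<open>n\<close> is a difference of two blocks starting at \<open>N\<close>.\<close>
      then obtain q where q: "1 / real (Suc q) < e / 2"
        using nat_approx_posE[of "e / 2"] by auto
      obtain N where N: "norm (\<Sum>i<j. d (N + i) \<omega>) < 1 / real (Suc q)" for j
        using elim by blast
      have N': "norm (\<Sum>i=N..<n. d i \<omega>) < e / 2" if "N \<le> n" for n
        using N[of "n - N"] q that sum.shift_bounds_nat_ivl[of "\<lambda>i. d i \<omega>" 0 N "n - N"]
        by (simp add: lessThan_atLeast0 add.commute)
      have "norm (\<Sum>i=m..<n. d i \<omega>) < e" if "N \<le> m" for m n
      proof (cases "m \<le> n")
        case True
        then have "(\<Sum>i=N..<n. d i \<omega>) = (\<Sum>i=N..<m. d i \<omega>) + (\<Sum>i=m..<n. d i \<omega>)"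
          using that by (simp add: sum.atLeastLessThan_concat)
        then have "(\<Sum>i=m..<n. d i \<omega>) = (\<Sum>i=N..<n. d i \<omega>) - (\<Sum>i=N..<m. d i \<omega>)"
          by simp
        then show ?thesis
          using norm_triangle_ineq4[of "\<Sum>i=N..<n. d i \<omega>" "\<Sum>i=N..<m. d i \<omega>"]
            N'[of n] N'[of m] that True by simp
      qed (use \<open>0 < e\<close> in simp)
      then show "\<exists>N. \<forall>m\<ge>N. \<forall>n. norm (\<Sum>i=m..<n. d i \<omega>) < e" by blast
    qed
  qed
qed

end

end

section \<open>Stochastic gradients along adapted points\<close>

text \<open>\<open>second_moment_integrable\<close> gives \<open>ABC\<close> its meaning: the
  Bochner integral of a non-integrable square is 0 and would satisfy the bound trivially.\<close>

locale stochastic_oracle = iid_samples M S \<xi> X + smooth_bounded f gradf L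
  for M :: "'w measure" and S :: "'s measure" and \<xi> :: "'w \<Rightarrow> 's" and X :: "nat \<Rightarrow> 'w \<Rightarrow> 's"
    and f :: "'v :: euclidean_space \<Rightarrow> real" and gradf :: "'v \<Rightarrow> 'v" and L :: real +
  fixes G :: "'v \<Rightarrow> 's \<Rightarrow> 'v" and A B C :: real
  assumes unbiased: "unbiased_stochastic_gradient M S \<xi> G gradf"
    and ABC_nonneg: "0 \<le> A" "0 \<le> B" "0 \<le> C"
    and second_moment_integrable: "integrable M (\<lambda>\<omega>. (norm (G x (\<xi> \<omega>)))\<^sup>2)"
    and ABC: "(\<integral>\<omega>. (norm (G x (\<xi> \<omega>)))\<^sup>2 \<partial>M) \<le> A * gap x + B * (norm (gradf x))\<^sup>2 + C"
begin

lemma measurable_oracle [measurable]: "(\<lambda>(x, s). G x s) \<in> borel_measurable (borel \<Otimes>\<^sub>M S)"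
  using unbiased by (simp add: unbiased_stochastic_gradient_def)

lemma integrable_oracle: "integrable M (\<lambda>\<omega>. G x (\<xi> \<omega>))"
  and integral_oracle: "(\<integral>\<omega>. G x (\<xi> \<omega>) \<partial>M) = gradf x"
  using unbiased by (simp_all add: unbiased_stochastic_gradient_def)

text \<open>By \<open>norm_grad_le_gap\<close> the \<open>B\<close> term folds into the gap
  term.\<close>

definition growth :: real where
  "growth = A + 4 * L * B"

lemma second_moment_le_gap: "(\<integral>\<omega>. (norm (G x (\<xi> \<omega>)))\<^sup>2 \<partial>M) \<le> growth * gap x + C"
  using ABC[of x] mult_left_mono[OF norm_grad_le_gap[of x] ABC_nonneg(2)]
  by (simp add: growth_def algebra_simps)

lemma growth_nonneg: "0 \<le> growth"
  using ABC_nonneg L_pos by (simp add: growth_def)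

text \<open>A generic random point determined by the first \<open>n\<close> samples; it is later
  taken to be the iterate \<open>x n\<close> and, for the gradient bound,
  \<open>z n\<close>.\<close>

context
  fixes x :: "'w \<Rightarrow> 'v" and n :: nat
  assumes x: "x \<in> borel_measurable (past n)"
    and gap_integrable: "integrable M (\<lambda>\<omega>. gap (x \<omega>))"
begin

abbreviation (input) sgrad where "sgrad \<equiv> \<lambda>\<omega>. G (x \<omega>) (X (Suc n) \<omega>)"

lemma measurable_oracle_past: "sgrad \<in> borel_measurable (past (Suc n))"
proof -
  have [measurable]: "x \<in> borel_measurable (past (Suc n))" "X (Suc n) \<in> measurable (past (Suc n)) S"
    using measurable_past_mono[OF _ x] measurable_sample_past by auto
  show ?thesis by measurable
qed

section \<open>Moments of the stochastic gradient and of its noise\<close>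

lemma square_integrable_grad: "integrable M (\<lambda>\<omega>. (norm (gradf (x \<omega>)))\<^sup>2)"
proof (rule Bochner_Integration.integrable_bound)
  show "integrable M (\<lambda>\<omega>. 4 * L * gap (x \<omega>))"
    using gap_integrable by simp
  have [measurable]: "x \<in> borel_measurable M"
    by (rule measurable_past_M[OF x])
  show "(\<lambda>\<omega>. (norm (gradf (x \<omega>)))\<^sup>2) \<in> borel_measurable M"
    by measurable
  show "AE \<omega> in M. norm ((norm (gradf (x \<omega>)))\<^sup>2) \<le> norm (4 * L * gap (x \<omega>))"
    using norm_grad_le_gap gap_nonneg L_pos by (auto simp: abs_mult)
qed

text \<open>The computation uses nonnegative extended integrals, so that square integrability comes
  out of the bound on the inner average instead of being presupposed.\<close>

lemma second_moment_oracle: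
  "integrable M (\<lambda>\<omega>. (norm (sgrad \<omega>))\<^sup>2)"
  "(\<integral>\<omega>. (norm (sgrad \<omega>))\<^sup>2 \<partial>M) \<le> growth * (\<integral>\<omega>. gap (x \<omega>) \<partial>M) + C"
proof -
  note [measurable] = x
  have [measurable]: "sgrad \<in> borel_measurable M"
    by (rule measurable_past_M[OF measurable_oracle_past])
  have "(\<lambda>(\<omega>, s). ennreal ((norm (G (x \<omega>) s))\<^sup>2)) \<in> borel_measurable (past n \<Otimes>\<^sub>M S)"
    by measurable
  from nn_integral_past_sample[OF this]
  have "(\<integral>\<^sup>+ \<omega>. ennreal ((norm (sgrad \<omega>))\<^sup>2) \<partial>M) =
      (\<integral>\<^sup>+ \<omega>. \<integral>\<^sup>+ \<omega>'. ennreal ((norm (G (x \<omega>) (\<xi> \<omega>')))\<^sup>2) \<partial>M \<partial>M)"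
    by simp
  also have "\<dots> = (\<integral>\<^sup>+ \<omega>. ennreal (\<integral>\<omega>'. (norm (G (x \<omega>) (\<xi> \<omega>')))\<^sup>2 \<partial>M) \<partial>M)"
    by (intro nn_integral_cong nn_integral_eq_integral second_moment_integrable) simp
  also have "\<dots> \<le> (\<integral>\<^sup>+ \<omega>. ennreal (growth * gap (x \<omega>) + C) \<partial>M)"
    by (intro nn_integral_mono ennreal_leI second_moment_le_gap)
  also have "\<dots> = ennreal (\<integral>\<omega>. growth * gap (x \<omega>) + C \<partial>M)"
    using gap_integrable gap_nonneg growth_nonneg ABC_nonneg
    by (intro nn_integral_eq_integral) auto
  also have "(\<integral>\<omega>. growth * gap (x \<omega>) + C \<partial>M) = growth * (\<integral>\<omega>. gap (x \<omega>) \<partial>M) + C"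
    using gap_integrable by (simp add: prob_space)
  finally have le: "(\<integral>\<^sup>+ \<omega>. ennreal ((norm (sgrad \<omega>))\<^sup>2) \<partial>M)
      \<le> ennreal (growth * (\<integral>\<omega>. gap (x \<omega>) \<partial>M) + C)" .
  show int: "integrable M (\<lambda>\<omega>. (norm (sgrad \<omega>))\<^sup>2)"
    using le by (intro integrableI_nonneg) (auto intro: le_less_trans)
  have "0 \<le> (\<integral>\<omega>. gap (x \<omega>) \<partial>M)"
    by (intro Bochner_Integration.integral_nonneg gap_nonneg)
  then show "(\<integral>\<omega>. (norm (sgrad \<omega>))\<^sup>2 \<partial>M) \<le> growth * (\<integral>\<omega>. gap (x \<omega>) \<partial>M) + C"
    using le growth_nonneg ABC_nonneg
    by (simp add: nn_integral_eq_integral[OF int] ennreal_le_iff del: ennreal_plus)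
qed

text \<open>With the past frozen, \<open>Y\<close> is constant, and unbiasedness turns the inner
  average into \<open>gradf\<close>.\<close>

lemma integral_inner_oracle:
  assumes Y: "Y \<in> borel_measurable (past n)" "integrable M (\<lambda>\<omega>. (norm (Y \<omega>))\<^sup>2)"
  shows "integrable M (\<lambda>\<omega>. Y \<omega> \<bullet> sgrad \<omega>)"
    and "(\<integral>\<omega>. Y \<omega> \<bullet> sgrad \<omega> \<partial>M) = (\<integral>\<omega>. Y \<omega> \<bullet> gradf (x \<omega>) \<partial>M)"
proof -
  note [measurable] = x Y(1)
  show int: "integrable M (\<lambda>\<omega>. Y \<omega> \<bullet> sgrad \<omega>)"
    by (intro integrable_inner_of_squares measurable_past_M[OF Y(1)] Y(2)
        measurable_past_M[OF measurable_oracle_past] second_moment_oracle(1))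
  have h: "(\<lambda>(\<omega>, s). Y \<omega> \<bullet> G (x \<omega>) s) \<in> borel_measurable (past n \<Otimes>\<^sub>M S)"
    by measurable
  show "(\<integral>\<omega>. Y \<omega> \<bullet> sgrad \<omega> \<partial>M) = (\<integral>\<omega>. Y \<omega> \<bullet> gradf (x \<omega>) \<partial>M)"
    using integral_past_sample[OF h] int integrable_oracle by (simp add: integral_oracle)
qed

text \<open>Variance is at most the second moment: testing with the gradient itself makes the cross
  term minus twice the mean squared gradient.\<close>

lemma square_integrable_oracle_noise: "integrable M (\<lambda>\<omega>. (norm (sgrad \<omega> - gradf (x \<omega>)))\<^sup>2)"
  and second_moment_oracle_noise:
    "(\<integral>\<omega>. (norm (sgrad \<omega> - gradf (x \<omega>)))\<^sup>2 \<partial>M) \<le> growth * (\<integral>\<omega>. gap (x \<omega>) \<partial>M) + C"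
proof -
  have [measurable]: "x \<in> borel_measurable (past n)" by (rule x)
  have grad: "(\<lambda>\<omega>. gradf (x \<omega>)) \<in> borel_measurable (past n)" by measurable
  have eq: "(norm (sgrad \<omega> - gradf (x \<omega>)))\<^sup>2 =
      (norm (sgrad \<omega>))\<^sup>2 - 2 * (gradf (x \<omega>) \<bullet> sgrad \<omega>) + (norm (gradf (x \<omega>)))\<^sup>2" for \<omega>
    by (simp add: power2_norm_eq_inner inner_diff_left inner_diff_right inner_commute)
  note ints = second_moment_oracle(1) square_integrable_grad
    integral_inner_oracle[OF grad square_integrable_grad]
  show "integrable M (\<lambda>\<omega>. (norm (sgrad \<omega> - gradf (x \<omega>)))\<^sup>2)"
    unfolding eq using ints by simp
  have "(\<integral>\<omega>. (norm (sgrad \<omega> - gradf (x \<omega>)))\<^sup>2 \<partial>M) =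
      (\<integral>\<omega>. (norm (sgrad \<omega>))\<^sup>2 \<partial>M) - (\<integral>\<omega>. (norm (gradf (x \<omega>)))\<^sup>2 \<partial>M)"
    unfolding eq using ints by (simp add: power2_norm_eq_inner)
  also have "\<dots> \<le> (\<integral>\<omega>. (norm (sgrad \<omega>))\<^sup>2 \<partial>M)"
    by (simp add: Bochner_Integration.integral_nonneg)
  finally show "(\<integral>\<omega>. (norm (sgrad \<omega> - gradf (x \<omega>)))\<^sup>2 \<partial>M) \<le> growth * (\<integral>\<omega>. gap (x \<omega>) \<partial>M) + C"
    using second_moment_oracle(2) by linarith
qed

end

end

section \<open>Perturbed stochastic gradient descent\<close>

text \<open>Both methods are instances of one recursion: the iterate is \<open>z + u\<close>, where \<open>z\<close> performs
  plain stochastic gradient descent with gradients taken at \<open>z + u\<close>, and the offset \<open>u\<close>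
  contracts by \<open>\<beta>\<close> up to a multiple of the same stochastic gradient.\<close>

locale perturbed_sgd = stochastic_oracle M S \<xi> X f gradf L G A B C
  for M :: "'w measure" and S :: "'s measure" and \<xi> :: "'w \<Rightarrow> 's" and X :: "nat \<Rightarrow> 'w \<Rightarrow> 's"
    and f :: "'v :: euclidean_space \<Rightarrow> real" and gradf :: "'v \<Rightarrow> 'v" and L :: real
    and G :: "'v \<Rightarrow> 's \<Rightarrow> 'v" and A B C :: real +
  fixes a :: "nat \<Rightarrow> real" and \<beta> \<gamma> \<kappa> :: real and z\<^sub>0 u\<^sub>0 :: 'v
  assumes beta: "0 \<le> \<beta>" "\<beta> < 1" and gamma_pos: "0 < \<gamma>"
    and a_pos: "0 < a n"
    and a_not_summable: "\<not> summable a"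
    and a_square_summable: "summable (\<lambda>n. (a n)\<^sup>2)"
begin

text \<open>Both components use the same stochastic gradient at \<open>z + u\<close>, hence one
  recursion on pairs. Stage \<open>n\<close> stands for time \<open>n + 1\<close> of the methods,
  which is why sample \<open>Suc n\<close> enters.\<close>

primrec state :: "nat \<Rightarrow> 'w \<Rightarrow> 'v \<times> 'v" where
  "state 0 \<omega> = (z\<^sub>0, u\<^sub>0)"
| "state (Suc n) \<omega> = (case state n \<omega> of (z, u) \<Rightarrow>
     (z - (\<gamma> * a n) *\<^sub>R G (z + u) (X (Suc n) \<omega>),
      \<beta> *\<^sub>R u + (\<kappa> * a n) *\<^sub>R G (z + u) (X (Suc n) \<omega>)))"

definition z :: "nat \<Rightarrow> 'w \<Rightarrow> 'v" where "z n \<omega> = fst (state n \<omega>)"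
definition u :: "nat \<Rightarrow> 'w \<Rightarrow> 'v" where "u n \<omega> = snd (state n \<omega>)"
definition x :: "nat \<Rightarrow> 'w \<Rightarrow> 'v" where "x n \<omega> = z n \<omega> + u n \<omega>"
definition g :: "nat \<Rightarrow> 'w \<Rightarrow> 'v" where "g n \<omega> = G (x n \<omega>) (X (Suc n) \<omega>)"

lemma z_simps: "z 0 \<omega> = z\<^sub>0" "z (Suc n) \<omega> = z n \<omega> - (\<gamma> * a n) *\<^sub>R g n \<omega>"
  and u_simps: "u 0 \<omega> = u\<^sub>0" "u (Suc n) \<omega> = \<beta> *\<^sub>R u n \<omega> + (\<kappa> * a n) *\<^sub>R g n \<omega>"
  by (simp_all add: z_def u_def x_def g_def split: prod.split)

lemma adapted: "z n \<in> borel_measurable (past n) \<and> u n \<in> borel_measurable (past n)"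
proof (induction n)
  case 0
  then show ?case by (simp add: z_simps(1)[abs_def] u_simps(1)[abs_def])
next
  case (Suc n)
  have [measurable]: "z n \<in> borel_measurable (past (Suc n))"
    "u n \<in> borel_measurable (past (Suc n))" "X (Suc n) \<in> measurable (past (Suc n)) S"
    using measurable_past_mono[of n "Suc n"] measurable_sample_past Suc by auto
  have "g n \<in> borel_measurable (past (Suc n))"
    unfolding g_def[abs_def] x_def by measurable
  then show ?case
    unfolding z_simps(2)[abs_def] u_simps(2)[abs_def]
    by (intro conjI borel_measurable_diff borel_measurable_add borel_measurable_scaleR
        borel_measurable_const) auto
qed

lemma z_adapted: "z n \<in> borel_measurable (past n)"
  and u_adapted: "u n \<in> borel_measurable (past n)"
  using adapted by auto

lemma x_adapted: "x n \<in> borel_measurable (past n)"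
  unfolding x_def[abs_def] using z_adapted u_adapted by simp

lemma measurable_iterates [measurable]:
  "z n \<in> borel_measurable M" "u n \<in> borel_measurable M" "x n \<in> borel_measurable M"
  by (rule measurable_past_M[OF z_adapted] measurable_past_M[OF u_adapted]
      measurable_past_M[OF x_adapted])+

text \<open>The update is a convex combination, with weights \<beta> and \<open>1 - \<beta>\<close>,
  of \<open>u\<close> and a rescaled gradient; convexity of the squared norm keeps the contraction
  factor \<beta>.\<close>

lemma norm_u_Suc_le:
  "(norm (u (Suc n) \<omega>))\<^sup>2
    \<le> \<beta> * (norm (u n \<omega>))\<^sup>2 + \<kappa>\<^sup>2 / (1 - \<beta>) * (a n)\<^sup>2 * (norm (g n \<omega>))\<^sup>2"
proof -
  have convex: "(norm (\<beta> *\<^sub>R v + (1 - \<beta>) *\<^sub>R w))\<^sup>2 \<le> \<beta> * (norm v)\<^sup>2 + (1 - \<beta>) * (norm w)\<^sup>2"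
    for v w :: 'v
  proof -
    have "(norm (\<beta> *\<^sub>R v + (1 - \<beta>) *\<^sub>R w))\<^sup>2 =
        \<beta> * (norm v)\<^sup>2 + (1 - \<beta>) * (norm w)\<^sup>2 - \<beta> * (1 - \<beta>) * (norm (v - w))\<^sup>2"
      by (simp add: power2_norm_eq_inner inner_add_left inner_add_right inner_diff_left
          inner_diff_right inner_commute algebra_simps)
    moreover have "0 \<le> \<beta> * (1 - \<beta>) * (norm (v - w))\<^sup>2"
      using beta by simp
    ultimately show ?thesis by linarith
  qed
  have "(1 - \<beta>) * (norm ((\<kappa> * a n / (1 - \<beta>)) *\<^sub>R g n \<omega>))\<^sup>2 =
      \<kappa>\<^sup>2 / (1 - \<beta>) * (a n)\<^sup>2 * (norm (g n \<omega>))\<^sup>2"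
    using beta by (simp add: power_mult_distrib power_divide power2_eq_square)
  then show ?thesis
    using convex[of "u n \<omega>" "(\<kappa> * a n / (1 - \<beta>)) *\<^sub>R g n \<omega>"] beta
    by (simp add: u_simps(2))
qed

lemma gap_z_Suc_le:
  "gap (z (Suc n) \<omega>)
    \<le> gap (z n \<omega>) - \<gamma> * a n * (gradf (z n \<omega>) \<bullet> g n \<omega>) + L * \<gamma>\<^sup>2 * (a n)\<^sup>2 * (norm (g n \<omega>))\<^sup>2"
  using gap_le[of "z (Suc n) \<omega>" "z n \<omega>"]
  by (simp add: z_simps(2) power_mult_distrib algebra_simps)

section \<open>Integrability along the trajectory\<close>

lemma integrable_gap_x_if:
  assumes "integrable M (\<lambda>\<omega>. gap (z n \<omega>))" "integrable M (\<lambda>\<omega>. (norm (u n \<omega>))\<^sup>2)"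
  shows "integrable M (\<lambda>\<omega>. gap (x n \<omega>))"
proof (rule Bochner_Integration.integrable_bound)
  show "integrable M (\<lambda>\<omega>. (1 + 2 * L) * (gap (z n \<omega>) + (norm (u n \<omega>))\<^sup>2))"
    using assms by simp
  show "AE \<omega> in M. norm (gap (x n \<omega>)) \<le> norm ((1 + 2 * L) * (gap (z n \<omega>) + (norm (u n \<omega>))\<^sup>2))"
  proof (rule AE_I2)
    fix \<omega>
    show "norm (gap (x n \<omega>)) \<le> norm ((1 + 2 * L) * (gap (z n \<omega>) + (norm (u n \<omega>))\<^sup>2))"
      using gap_add_le[of "z n \<omega>" "u n \<omega>"] gap_nonneg[of "x n \<omega>"] gap_nonneg[of "z n \<omega>"] L_pos
      by (simp add: x_def)
  qed
qed measurable

text \<open>A joint induction, because the gradient is sampled at \<open>z + u\<close>. The one-step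
  inequalities dominate the nonnegative quantities at stage \<open>Suc n\<close> by integrable
  ones.\<close>

lemma integrable_gap_z_u:
  "integrable M (\<lambda>\<omega>. gap (z n \<omega>)) \<and> integrable M (\<lambda>\<omega>. (norm (u n \<omega>))\<^sup>2)"
proof (induction n)
  case 0
  then show ?case by (simp add: z_simps(1) u_simps(1))
next
  case (Suc n)
  note x = x_adapted[of n] integrable_gap_x_if[OF conjunct1[OF Suc] conjunct2[OF Suc]]
  have gradz: "(\<lambda>\<omega>. gradf (z n \<omega>)) \<in> borel_measurable (past n)"
    using z_adapted[of n] by measurable
  have [measurable]: "g n \<in> borel_measurable M"
    unfolding g_def[abs_def] by (rule measurable_past_M[OF measurable_oracle_past[OF x]])
  have g: "integrable M (\<lambda>\<omega>. (norm (g n \<omega>))\<^sup>2)"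
    "integrable M (\<lambda>\<omega>. gradf (z n \<omega>) \<bullet> g n \<omega>)"
    unfolding g_def
    using second_moment_oracle(1)[OF x]
      integral_inner_oracle(1)[OF x gradz square_integrable_grad[OF z_adapted conjunct1[OF Suc]]]
    by simp_all
  have "integrable M (\<lambda>\<omega>. gap (z (Suc n) \<omega>))"
  proof (rule Bochner_Integration.integrable_bound)
    show "integrable M (\<lambda>\<omega>. gap (z n \<omega>) - \<gamma> * a n * (gradf (z n \<omega>) \<bullet> g n \<omega>) +
        L * \<gamma>\<^sup>2 * (a n)\<^sup>2 * (norm (g n \<omega>))\<^sup>2)"
      using Suc g by simp
    show "AE \<omega> in M. norm (gap (z (Suc n) \<omega>)) \<le> norm (gap (z n \<omega>) -
        \<gamma> * a n * (gradf (z n \<omega>) \<bullet> g n \<omega>) + L * \<gamma>\<^sup>2 * (a n)\<^sup>2 * (norm (g n \<omega>))\<^sup>2)"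
      unfolding real_norm_def abs_of_nonneg[OF gap_nonneg]
      by (intro AE_I2 order_trans[OF gap_z_Suc_le abs_ge_self])
  qed measurable
  moreover have "integrable M (\<lambda>\<omega>. (norm (u (Suc n) \<omega>))\<^sup>2)"
  proof (rule Bochner_Integration.integrable_bound)
    show "integrable M (\<lambda>\<omega>. \<beta> * (norm (u n \<omega>))\<^sup>2 +
        \<kappa>\<^sup>2 / (1 - \<beta>) * (a n)\<^sup>2 * (norm (g n \<omega>))\<^sup>2)"
      using Suc g by simp
    show "AE \<omega> in M. norm ((norm (u (Suc n) \<omega>))\<^sup>2) \<le> norm (\<beta> * (norm (u n \<omega>))\<^sup>2 +
        \<kappa>\<^sup>2 / (1 - \<beta>) * (a n)\<^sup>2 * (norm (g n \<omega>))\<^sup>2)"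
      unfolding real_norm_def abs_of_nonneg[OF zero_le_power2]
      by (intro AE_I2 order_trans[OF norm_u_Suc_le abs_ge_self])
  qed measurable
  ultimately show ?case ..
qed

lemma integrable_gap_z: "integrable M (\<lambda>\<omega>. gap (z n \<omega>))"
  and integrable_u: "integrable M (\<lambda>\<omega>. (norm (u n \<omega>))\<^sup>2)"
  using integrable_gap_z_u by auto

lemma integrable_gap_x: "integrable M (\<lambda>\<omega>. gap (x n \<omega>))"
  by (rule integrable_gap_x_if[OF integrable_gap_z integrable_u])

lemmas square_integrable_grad_x = square_integrable_grad[OF x_adapted integrable_gap_x]

lemma square_integrable_g: "integrable M (\<lambda>\<omega>. (norm (g n \<omega>))\<^sup>2)"
  unfolding g_def by (rule second_moment_oracle(1)[OF x_adapted integrable_gap_x])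

lemma gradf_z_adapted: "(\<lambda>\<omega>. gradf (z n \<omega>)) \<in> borel_measurable (past n)"
  using z_adapted[of n] by measurable

lemmas square_integrable_grad_z = square_integrable_grad[OF z_adapted integrable_gap_z]

lemma integrable_inner_grad_z_g: "integrable M (\<lambda>\<omega>. gradf (z n \<omega>) \<bullet> g n \<omega>)"
  and integral_inner_grad_z_g: "(\<integral>\<omega>. gradf (z n \<omega>) \<bullet> g n \<omega> \<partial>M) =
    (\<integral>\<omega>. gradf (z n \<omega>) \<bullet> gradf (x n \<omega>) \<partial>M)"
  unfolding g_def
  by (rule integral_inner_oracle[OF x_adapted integrable_gap_x gradf_z_adapted
        square_integrable_grad_z])+

text \<open>Polarization with the squared gradient at \<open>z\<close> dropped; the remaining error
  is Lipschitz in \<open>x - z\<close>, that is, in the offset \<open>u\<close>.\<close>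

lemma integral_inner_grad_ge:
  "(\<integral>\<omega>. (norm (gradf (x n \<omega>)))\<^sup>2 \<partial>M) / 2 - L\<^sup>2 / 2 * (\<integral>\<omega>. (norm (u n \<omega>))\<^sup>2 \<partial>M)
    \<le> (\<integral>\<omega>. gradf (z n \<omega>) \<bullet> gradf (x n \<omega>) \<partial>M)"
proof -
  have le: "(norm (gradf (x n \<omega>)))\<^sup>2 / 2 - L\<^sup>2 / 2 * (norm (u n \<omega>))\<^sup>2
      \<le> gradf (z n \<omega>) \<bullet> gradf (x n \<omega>)" for \<omega>
  proof -
    have "norm (gradf (x n \<omega>) - gradf (z n \<omega>)) \<le> L * norm (u n \<omega>)"
      using smooth[of "x n \<omega>" "z n \<omega>"] by (simp add: x_def)
    then have "(norm (gradf (x n \<omega>) - gradf (z n \<omega>)))\<^sup>2 \<le> L\<^sup>2 * (norm (u n \<omega>))\<^sup>2"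
      using power_mono[of _ _ 2] by (fastforce simp: power_mult_distrib)
    moreover have "(norm (gradf (x n \<omega>) - gradf (z n \<omega>)))\<^sup>2 =
        (norm (gradf (x n \<omega>)))\<^sup>2 + (norm (gradf (z n \<omega>)))\<^sup>2 - 2 * (gradf (z n \<omega>) \<bullet> gradf (x n \<omega>))"
      by (simp add: power2_norm_eq_inner inner_diff_left inner_diff_right inner_commute)
    ultimately show ?thesis
      using zero_le_power2[of "norm (gradf (z n \<omega>))"] by linarith
  qed
  have "(\<integral>\<omega>. (norm (gradf (x n \<omega>)))\<^sup>2 / 2 - L\<^sup>2 / 2 * (norm (u n \<omega>))\<^sup>2 \<partial>M)
      \<le> (\<integral>\<omega>. gradf (z n \<omega>) \<bullet> gradf (x n \<omega>) \<partial>M)"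
    using square_integrable_grad_x integrable_u square_integrable_grad_z
    by (intro integral_mono le integrable_inner_of_squares) auto
  then show ?thesis
    using square_integrable_grad_x integrable_u by simp
qed

section \<open>Descent in expectation\<close>

lemma a_tendsto_zero: "a \<longlonglongrightarrow> 0"
  using tendsto_real_sqrt[OF summable_LIMSEQ_zero[OF a_square_summable]] a_pos
  by (simp add: less_imp_le)

text \<open>The Lyapunov function \<open>E [gap z + K * |u|\<^sup>2]\<close>: with \<open>K\<close> large, the contraction of \<open>u\<close> pays
  for evaluating the gradient at \<open>z + u\<close> instead of \<open>z\<close>.\<close>

lemma expected_descent:
  obtains V p q :: "nat \<Rightarrow> real"
  where "\<And>n. 0 \<le> V n" "\<And>n. 0 \<le> p n" "\<And>n. 0 \<le> q n" "summable p" "summable q"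
    and "\<And>n. V (Suc n) + (\<gamma> / 2 * a n * (\<integral>\<omega>. (norm (gradf (x n \<omega>)))\<^sup>2 \<partial>M)
      + (\<integral>\<omega>. (norm (u n \<omega>))\<^sup>2 \<partial>M)) \<le> (1 + p n) * V n + q n"
    and "\<And>n. (\<integral>\<omega>. gap (x n \<omega>) \<partial>M) \<le> (1 + 2 * L) * V n"
proof -
  obtain b where "norm (a n) \<le> b" for n
    using BseqE[OF convergent_imp_Bseq[OF convergentI[OF a_tendsto_zero]]] by blast
  then have b: "a n \<le> b" for n
    using a_pos[of n] by (fastforce simp: abs_le_iff)
  have b_pos: "0 < b" using a_pos[of 0] b[of 0] by linarith
  \<comment> \<open>\<open>K * (1 - \<beta>)\<close> has two parts:
    \<open>\<gamma> * b * L\<^sup>2 / 2\<close> pays for the gradient mismatch, as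
    \<open>a n\<close> is at most \<open>b\<close>, and the remaining 1 leaves the second moment of
    \<open>u\<close> to be summed.\<close>
  define K where "K = (1 + \<gamma> * b * L\<^sup>2 / 2) / (1 - \<beta>)"
  have "0 \<le> \<gamma> * b * L\<^sup>2 / 2"
    using gamma_pos b_pos by simp
  then have "1 - \<beta> \<le> 1 + \<gamma> * b * L\<^sup>2 / 2"
    using beta(1) by linarith
  then have K: "1 \<le> K" "K * (1 - \<beta>) = 1 + \<gamma> * b * L\<^sup>2 / 2"
    using beta by (simp_all add: K_def)
  \<comment> \<open>The one-step inequalities for \<open>z\<close> and \<open>u\<close> both
    contribute the squared step times the second moment of \<open>g\<close>; \<open>c\<close> is the
    combined coefficient.\<close>
  define c where "c = L * \<gamma>\<^sup>2 + K * (\<kappa>\<^sup>2 / (1 - \<beta>))"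
  have c: "0 \<le> c" using L_pos K beta by (simp add: c_def)
  define V where "V n = (\<integral>\<omega>. gap (z n \<omega>) \<partial>M) + K * (\<integral>\<omega>. (norm (u n \<omega>))\<^sup>2 \<partial>M)" for n
  have V_nonneg: "0 \<le> V n" for n
    using K by (auto simp: V_def gap_nonneg intro!: add_nonneg_nonneg mult_nonneg_nonneg
        Bochner_Integration.integral_nonneg)
  have gap_x: "(\<integral>\<omega>. gap (x n \<omega>) \<partial>M) \<le> (1 + 2 * L) * V n" for n
  proof -
    have "(\<integral>\<omega>. gap (x n \<omega>) \<partial>M) \<le> (\<integral>\<omega>. (1 + 2 * L) * (gap (z n \<omega>) + (norm (u n \<omega>))\<^sup>2) \<partial>M)"
      using gap_add_le integrable_gap_x integrable_gap_z integrable_u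
      by (intro integral_mono) (auto simp: x_def)
    also have "\<dots> = (1 + 2 * L) * ((\<integral>\<omega>. gap (z n \<omega>) \<partial>M) + (\<integral>\<omega>. (norm (u n \<omega>))\<^sup>2 \<partial>M))"
      using integrable_gap_z integrable_u by simp
    also have "\<dots> \<le> (1 + 2 * L) * V n"
      using mult_right_mono[OF K(1), of "\<integral>\<omega>. (norm (u n \<omega>))\<^sup>2 \<partial>M"] L_pos
      unfolding V_def by (intro mult_left_mono) (auto simp: Bochner_Integration.integral_nonneg)
    finally show ?thesis .
  qed
  \<comment> \<open>\<open>p\<close> and \<open>q\<close> arise from bounding the second moment of
    \<open>g\<close> by \<open>growth\<close> times the mean gap plus \<open>C\<close>, and the mean
    gap by \<open>gap_x\<close>.\<close>
  define p where "p n = c * growth * (1 + 2 * L) * (a n)\<^sup>2" for n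
  define q where "q n = c * C * (a n)\<^sup>2" for n
  have step: "V (Suc n) + (\<gamma> / 2 * a n * (\<integral>\<omega>. (norm (gradf (x n \<omega>)))\<^sup>2 \<partial>M)
      + (\<integral>\<omega>. (norm (u n \<omega>))\<^sup>2 \<partial>M)) \<le> (1 + p n) * V n + q n" for n
  proof -
    let ?Eg = "\<integral>\<omega>. (norm (g n \<omega>))\<^sup>2 \<partial>M" and ?Eu = "\<integral>\<omega>. (norm (u n \<omega>))\<^sup>2 \<partial>M"
      and ?Ex = "\<integral>\<omega>. (norm (gradf (x n \<omega>)))\<^sup>2 \<partial>M"
      and ?Ezx = "\<integral>\<omega>. gradf (z n \<omega>) \<bullet> gradf (x n \<omega>) \<partial>M"
    note ints = integrable_gap_z integrable_u square_integrable_g integrable_inner_grad_z_g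
    have "(\<integral>\<omega>. gap (z (Suc n) \<omega>) \<partial>M) \<le> (\<integral>\<omega>. gap (z n \<omega>) - \<gamma> * a n * (gradf (z n \<omega>) \<bullet> g n \<omega>)
        + L * \<gamma>\<^sup>2 * (a n)\<^sup>2 * (norm (g n \<omega>))\<^sup>2 \<partial>M)"
      using ints by (intro integral_mono gap_z_Suc_le) auto
    also have "\<dots> = (\<integral>\<omega>. gap (z n \<omega>) \<partial>M) - \<gamma> * a n * ?Ezx + L * \<gamma>\<^sup>2 * (a n)\<^sup>2 * ?Eg"
      using ints by (simp add: integral_inner_grad_z_g)
    finally have z: "(\<integral>\<omega>. gap (z (Suc n) \<omega>) \<partial>M) \<le> \<dots>" .
    have "(\<integral>\<omega>. (norm (u (Suc n) \<omega>))\<^sup>2 \<partial>M) \<le> (\<integral>\<omega>. \<beta> * (norm (u n \<omega>))\<^sup>2 +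
        \<kappa>\<^sup>2 / (1 - \<beta>) * (a n)\<^sup>2 * (norm (g n \<omega>))\<^sup>2 \<partial>M)"
      using ints by (intro integral_mono norm_u_Suc_le) auto
    also have "\<dots> = \<beta> * ?Eu + \<kappa>\<^sup>2 / (1 - \<beta>) * (a n)\<^sup>2 * ?Eg"
      using ints by simp
    finally have "K * (\<integral>\<omega>. (norm (u (Suc n) \<omega>))\<^sup>2 \<partial>M)
        \<le> K * (\<beta> * ?Eu + \<kappa>\<^sup>2 / (1 - \<beta>) * (a n)\<^sup>2 * ?Eg)"
      using K(1) by (intro mult_left_mono) auto
    with z have "V (Suc n) \<le> V n - \<gamma> * a n * ?Ezx - K * (1 - \<beta>) * ?Eu + c * (a n)\<^sup>2 * ?Eg"
      by (simp add: V_def c_def algebra_simps)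
    moreover have "\<gamma> * a n * (?Ex / 2 - L\<^sup>2 / 2 * ?Eu) \<le> \<gamma> * a n * ?Ezx"
      using gamma_pos a_pos[of n] by (intro mult_left_mono integral_inner_grad_ge) auto
    moreover have "\<gamma> * a n * (L\<^sup>2 / 2 * ?Eu) \<le> \<gamma> * b * (L\<^sup>2 / 2 * ?Eu)"
      using gamma_pos b[of n]
      by (intro mult_right_mono mult_left_mono mult_nonneg_nonneg) auto
    moreover have "c * (a n)\<^sup>2 * ?Eg \<le> c * (a n)\<^sup>2 * (growth * ((1 + 2 * L) * V n) + C)"
    proof (rule mult_left_mono)
      have "?Eg \<le> growth * (\<integral>\<omega>. gap (x n \<omega>) \<partial>M) + C"
        unfolding g_def by (rule second_moment_oracle(2)[OF x_adapted integrable_gap_x])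
      also have "\<dots> \<le> growth * ((1 + 2 * L) * V n) + C"
        by (intro add_right_mono mult_left_mono gap_x growth_nonneg)
      finally show "?Eg \<le> growth * ((1 + 2 * L) * V n) + C" .
    qed (use c in simp)
    ultimately show ?thesis
      unfolding K(2) p_def q_def by (simp add: algebra_simps)
  qed
  show thesis
  proof (rule that[of V p q])
    show "0 \<le> p n" "0 \<le> q n" for n
      using c growth_nonneg L_pos ABC_nonneg by (simp_all add: p_def q_def)
    show "summable p" "summable q"
      unfolding p_def q_def by (intro summable_mult a_square_summable)+
  qed (use V_nonneg step gap_x in auto)
qed

text \<open>The expected descent fits \<open>summable_of_linear_recursion\<close>. The bound on
  \<open>V\<close> also bounds the noise variances, so the scaled noise is dominated by a multiple
  of the squared steps.\<close>

lemma summable_second_moments: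
  shows "summable (\<lambda>n. \<integral>\<omega>. a n * (norm (gradf (x n \<omega>)))\<^sup>2 \<partial>M)"
    and "summable (\<lambda>n. \<integral>\<omega>. (norm (u n \<omega>))\<^sup>2 \<partial>M)"
    and "summable (\<lambda>n. \<integral>\<omega>. (norm (a n *\<^sub>R (g n \<omega> - gradf (x n \<omega>))))\<^sup>2 \<partial>M)"
proof -
  let ?Ex = "\<lambda>n. \<integral>\<omega>. (norm (gradf (x n \<omega>)))\<^sup>2 \<partial>M" and ?Eu = "\<lambda>n. \<integral>\<omega>. (norm (u n \<omega>))\<^sup>2 \<partial>M"
  obtain V p q :: "nat \<Rightarrow> real"
    where *: "\<And>n. 0 \<le> V n" "\<And>n. 0 \<le> p n" "\<And>n. 0 \<le> q n" "summable p" "summable q"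
      and step: "\<And>n. V (Suc n) + (\<gamma> / 2 * a n * ?Ex n + ?Eu n) \<le> (1 + p n) * V n + q n"
      and gap: "\<And>n. (\<integral>\<omega>. gap (x n \<omega>) \<partial>M) \<le> (1 + 2 * L) * V n"
    by (rule expected_descent) blast
  have nonneg: "0 \<le> \<gamma> / 2 * a n * ?Ex n" "0 \<le> ?Eu n" for n
    using gamma_pos a_pos[of n] by (simp_all add: Bochner_Integration.integral_nonneg)
  have "0 \<le> \<gamma> / 2 * a n * ?Ex n + ?Eu n" for n
    using nonneg by (rule add_nonneg_nonneg)
  note rec = summable_of_linear_recursion[of V p q "\<lambda>n. \<gamma> / 2 * a n * ?Ex n + ?Eu n",
      OF *(1-3) this step *(4-5)]
  have "summable (\<lambda>n. \<gamma> / 2 * a n * ?Ex n)"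
    by (rule summable_comparison_test'[OF rec(2), of 0]) (use nonneg in auto)
  from summable_mult[OF this, of "2 / \<gamma>"]
  show "summable (\<lambda>n. \<integral>\<omega>. a n * (norm (gradf (x n \<omega>)))\<^sup>2 \<partial>M)"
    using gamma_pos square_integrable_grad_x by simp
  show "summable (\<lambda>n. ?Eu n)"
    by (rule summable_comparison_test'[OF rec(2), of 0]) (use nonneg in auto)
  obtain c where c: "V n \<le> c" for n using rec(1) by blast
  have le: "(\<integral>\<omega>. (norm (a n *\<^sub>R (g n \<omega> - gradf (x n \<omega>))))\<^sup>2 \<partial>M)
      \<le> (a n)\<^sup>2 * (growth * ((1 + 2 * L) * c) + C)" for n
  proof -
    have "(\<integral>\<omega>. (norm (a n *\<^sub>R (g n \<omega> - gradf (x n \<omega>))))\<^sup>2 \<partial>M) =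
        (a n)\<^sup>2 * (\<integral>\<omega>. (norm (g n \<omega> - gradf (x n \<omega>)))\<^sup>2 \<partial>M)"
      by (simp add: power_mult_distrib)
    also have "\<dots> \<le> (a n)\<^sup>2 * (growth * (\<integral>\<omega>. gap (x n \<omega>) \<partial>M) + C)"
      unfolding g_def
      by (intro mult_left_mono second_moment_oracle_noise[OF x_adapted integrable_gap_x]) simp
    also have "\<dots> \<le> (a n)\<^sup>2 * (growth * ((1 + 2 * L) * c) + C)"
      using L_pos c by (intro mult_left_mono add_right_mono order_trans[OF gap] growth_nonneg) auto
    finally show ?thesis .
  qed
  have "summable (\<lambda>n. (a n)\<^sup>2 * (growth * ((1 + 2 * L) * c) + C))"
    by (intro summable_mult2 a_square_summable)
  then show "summable (\<lambda>n. \<integral>\<omega>. (norm (a n *\<^sub>R (g n \<omega> - gradf (x n \<omega>))))\<^sup>2 \<partial>M)"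
    by (rule summable_comparison_test'[of _ 0]) (use le in \<open>simp add: Bochner_Integration.integral_nonneg\<close>)
qed

text \<open>The noise is centred because \<open>integral_inner_oracle\<close> gives \<open>g\<close>
  and the true gradient the same pairing with every admissible \<open>Y\<close>.\<close>

lemma AE_summable_noise: "AE \<omega> in M. summable (\<lambda>n. a n *\<^sub>R (g n \<omega> - gradf (x n \<omega>)))"
proof (rule AE_summable_centred)
  fix n
  have [measurable]: "x n \<in> borel_measurable (past (Suc n))"
    using measurable_past_mono[OF _ x_adapted] by auto
  have [measurable]: "g n \<in> borel_measurable (past (Suc n))"
    unfolding g_def[abs_def] by (rule measurable_oracle_past[OF x_adapted integrable_gap_x])
  show "(\<lambda>\<omega>. a n *\<^sub>R (g n \<omega> - gradf (x n \<omega>))) \<in> borel_measurable (past (Suc n))"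
    by measurable
  show "integrable M (\<lambda>\<omega>. (norm (a n *\<^sub>R (g n \<omega> - gradf (x n \<omega>))))\<^sup>2)"
    unfolding g_def using square_integrable_oracle_noise[OF x_adapted integrable_gap_x, of n]
    by (simp add: power_mult_distrib)
  fix Y :: "'w \<Rightarrow> 'v"
  assume Y: "Y \<in> borel_measurable (past n)" "integrable M (\<lambda>\<omega>. (norm (Y \<omega>))\<^sup>2)"
  note inner = integral_inner_oracle[OF x_adapted integrable_gap_x Y]
  have "integrable M (\<lambda>\<omega>. Y \<omega> \<bullet> gradf (x n \<omega>))"
    by (intro integrable_inner_of_squares measurable_past_M[OF Y(1)] Y(2)
        square_integrable_grad_x) measurable
  then show "(\<integral>\<omega>. Y \<omega> \<bullet> (a n *\<^sub>R (g n \<omega> - gradf (x n \<omega>))) \<partial>M) = 0"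
    unfolding g_def using inner by (simp add: inner_diff_right)
qed (rule summable_second_moments(3))

section \<open>Pathwise convergence of the gradients\<close>

lemma z_diff:
  assumes "m \<le> n"
  shows "z n \<omega> - z m \<omega> = - (\<gamma> *\<^sub>R ((\<Sum>i=m..<n. a i *\<^sub>R gradf (x i \<omega>)) +
    (\<Sum>i=m..<n. a i *\<^sub>R (g i \<omega> - gradf (x i \<omega>)))))"
  using assms
proof (induction n rule: dec_induct)
  case (step n)
  then show ?case by (simp add: z_simps(2) algebra_simps)
qed simp

text \<open>By Lipschitz continuity the gradient norm grows at most by \<open>L\<close> times the
  displacement of \<open>x\<close>, which consists of drift, a noise block and two offsets; this is
  the slow variation required.\<close>

lemma tendsto_grad_of_summable:
  assumes grad: "summable (\<lambda>n. a n * (norm (gradf (x n \<omega>)))\<^sup>2)"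
    and offset: "summable (\<lambda>n. (norm (u n \<omega>))\<^sup>2)"
    and noise: "summable (\<lambda>n. a n *\<^sub>R (g n \<omega> - gradf (x n \<omega>)))"
  shows "(\<lambda>n. gradf (x n \<omega>)) \<longlonglongrightarrow> 0"
proof (rule tendsto_norm_zero_cancel,
    rule tendsto_zero_of_slow_variation[where a = a and K = "L * \<gamma>"])
  fix \<delta> :: real assume "0 < \<delta>"
  \<comment> \<open>\<open>e\<close> bounds the noise block, which carries the factor \<gamma>, and
    each of the two offsets; after multiplication by \<open>L\<close> these errors add up to
    \<delta>.\<close>
  define e where "e = \<delta> / (L * (\<gamma> + 2))"
  have pos: "0 < L * (\<gamma> + 2)"
    using L_pos gamma_pos by simp
  then have "e * (L * (\<gamma> + 2)) = \<delta>"
    unfolding e_def by (metis less_irrefl nonzero_eq_divide_eq)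
  then have e: "0 < e" "L * (\<gamma> * e + 2 * e) = \<delta>"
    using divide_pos_pos[OF \<open>0 < \<delta>\<close> pos] by (simp only: e_def, simp only: ring_distribs mult_ac)
  obtain N1 where N1: "norm (\<Sum>i=m..<n. a i *\<^sub>R (g i \<omega> - gradf (x i \<omega>))) < e" if "N1 \<le> m" for m n
    using noise e(1) unfolding summable_Cauchy by blast
  have "(\<lambda>n. norm (u n \<omega>)) \<longlonglongrightarrow> 0"
    using tendsto_real_sqrt[OF summable_LIMSEQ_zero[OF offset]] by simp
  then obtain N2 where N2: "norm (u n \<omega>) < e" if "N2 \<le> n" for n
    using LIMSEQ_D[of _ 0 e] e(1) by fastforce
  have "norm (gradf (x n \<omega>)) \<le> norm (gradf (x m \<omega>)) +
      L * \<gamma> * (\<Sum>i=m..<n. a i * norm (gradf (x i \<omega>))) + \<delta>"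
    if "max N1 N2 \<le> m" "m \<le> n" for m n
  proof -
    let ?S = "\<Sum>i=m..<n. a i *\<^sub>R gradf (x i \<omega>)"
    let ?D = "\<Sum>i=m..<n. a i *\<^sub>R (g i \<omega> - gradf (x i \<omega>))"
    have "norm ?S \<le> (\<Sum>i=m..<n. a i * norm (gradf (x i \<omega>)))"
      using a_pos by (intro sum_norm_le) (simp add: less_imp_le)
    moreover have "norm ?D \<le> e"
      using N1[of m n] that by simp
    ultimately have "norm (z n \<omega> - z m \<omega>) \<le> \<gamma> * ((\<Sum>i=m..<n. a i * norm (gradf (x i \<omega>))) + e)"
      unfolding z_diff[OF that(2)] using gamma_pos norm_triangle_ineq[of ?S ?D] by simp
    moreover have "x n \<omega> - x m \<omega> = (z n \<omega> - z m \<omega>) + (u n \<omega> - u m \<omega>)"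
      by (simp add: x_def)
    then have "norm (x n \<omega> - x m \<omega>) \<le> norm (z n \<omega> - z m \<omega>) + (norm (u n \<omega>) + norm (u m \<omega>))"
      using norm_triangle_ineq[of "z n \<omega> - z m \<omega>" "u n \<omega> - u m \<omega>"]
        norm_triangle_ineq4[of "u n \<omega>" "u m \<omega>"] by simp
    ultimately have "norm (x n \<omega> - x m \<omega>)
        \<le> \<gamma> * (\<Sum>i=m..<n. a i * norm (gradf (x i \<omega>))) + (\<gamma> * e + 2 * e)"
      using N2[of n] N2[of m] that by (simp add: algebra_simps)
    then have "L * norm (x n \<omega> - x m \<omega>)
        \<le> L * (\<gamma> * (\<Sum>i=m..<n. a i * norm (gradf (x i \<omega>))) + (\<gamma> * e + 2 * e))"
      using L_pos by (intro mult_left_mono) auto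
    also have "\<dots> = L * \<gamma> * (\<Sum>i=m..<n. a i * norm (gradf (x i \<omega>))) + \<delta>"
      using e(2) by (simp add: distrib_left mult.assoc)
    finally show ?thesis
      using smooth[of "x n \<omega>" "x m \<omega>"] norm_triangle_ineq2[of "gradf (x n \<omega>)" "gradf (x m \<omega>)"]
      by linarith
  qed
  then show "\<exists>N. \<forall>m\<ge>N. \<forall>n\<ge>m. norm (gradf (x n \<omega>)) \<le> norm (gradf (x m \<omega>)) +
      L * \<gamma> * (\<Sum>i=m..<n. a i * norm (gradf (x i \<omega>))) + \<delta>"
    by blast
qed (use a_pos L_pos gamma_pos a_tendsto_zero a_not_summable grad in \<open>auto simp: less_imp_le\<close>)

theorem AE_tendsto_grad: "AE \<omega> in M. (\<lambda>n. gradf (x n \<omega>)) \<longlonglongrightarrow> 0"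
proof -
  have "AE \<omega> in M. summable (\<lambda>n. a n * (norm (gradf (x n \<omega>)))\<^sup>2)"
    using a_pos square_integrable_grad_x summable_second_moments(1)
    by (intro AE_summable_of_summable_integral) (auto simp: less_imp_le)
  moreover have "AE \<omega> in M. summable (\<lambda>n. (norm (u n \<omega>))\<^sup>2)"
    using integrable_u summable_second_moments(2)
    by (intro AE_summable_of_summable_integral) auto
  ultimately show ?thesis
    using AE_summable_noise by eventually_elim (rule tendsto_grad_of_summable)
qed

end

section \<open>Heavy ball and Nesterov momentum\<close>

lemma not_summable_of_partial_sums_at_top:
  fixes a :: "nat \<Rightarrow> real"
  assumes "filterlim (\<lambda>n. \<Sum>t=1..n. a t) at_top sequentially"
  shows "\<not> summable (\<lambda>n. a (Suc n))"
proof
  assume "summable (\<lambda>n. a (Suc n))"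
  then have "(\<lambda>n. \<Sum>t<n. a (Suc t)) \<longlonglongrightarrow> (\<Sum>n. a (Suc n))"
    by (rule summable_LIMSEQ)
  moreover have "(\<Sum>t<n. a (Suc t)) = (\<Sum>t=1..n. a t)" for n
    by (simp add: sum.atLeast1_atMost_eq)
  ultimately have "(\<lambda>n. \<Sum>t=1..n. a t) \<longlonglongrightarrow> (\<Sum>n. a (Suc n))"
    by simp
  then show False
    using not_tendsto_and_filterlim_at_infinity[OF _ _ filterlim_at_top_imp_at_infinity[OF assms]]
    by simp
qed

theorem theorem11:
  fixes f :: "real ^ 'd \<Rightarrow> real"
    and gradf :: "real ^ 'd \<Rightarrow> real ^ 'd"
    and G :: "real ^ 'd \<Rightarrow> 's \<Rightarrow> real ^ 'd"
    and M :: "'w measure" and S :: "'s measure"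
    and \<xi> :: "'w \<Rightarrow> 's" and \<xi>s :: "nat \<Rightarrow> 'w \<Rightarrow> 's"
    and \<alpha> :: "nat \<Rightarrow> real" and \<beta> L A B C :: real
  assumes M: "prob_space M"
    and grad: "\<And>x. GDERIV f x :> gradf x"
    and grad_cont: "continuous_on UNIV gradf"
    and bdd: "bdd_below (range f)"
    and smooth: "\<And>x y. norm (gradf x - gradf y) \<le> L * norm (x - y)"
    and unbiased: "unbiased_stochastic_gradient M S \<xi> G gradf"
    and ABC_nonneg: "A \<ge> 0" "B \<ge> 0" "C \<ge> 0"
    and second_moment_integrable: "\<And>x. integrable M (\<lambda>\<omega>. (norm (G x (\<xi> \<omega>)))\<^sup>2)"
    and ABC: "\<And>x. (\<integral>\<omega>. (norm (G x (\<xi> \<omega>)))\<^sup>2 \<partial>M)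
                 \<le> A * (f x - (INF z. f z)) + B * (norm (gradf x))\<^sup>2 + C"
    and iid: "iid_copies M S \<xi> {1..} \<xi>s"
    and beta: "0 \<le> \<beta>" "\<beta> < 1"
    and alpha_pos: "\<And>t. t \<ge> 1 \<Longrightarrow> \<alpha> t > 0"
    and alpha_sum: "filterlim (\<lambda>n. \<Sum>t=1..n. \<alpha> t) at_top sequentially"
    and alpha_sq: "summable (\<lambda>t. (\<alpha> (t + 1))\<^sup>2)"
  shows "(\<forall>a\<^sub>0 a\<^sub>1 x. SHB M G \<xi>s \<alpha> \<beta> a\<^sub>0 a\<^sub>1 x \<longrightarrow>
            (AE \<omega> in M. (\<lambda>t. gradf (x t \<omega>)) \<longlonglongrightarrow> 0)) \<and>
         (\<forall>a\<^sub>1 b\<^sub>1 x y. SNAG M G \<xi>s \<alpha> \<beta> a\<^sub>1 b\<^sub>1 x y \<longrightarrow>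
            (AE \<omega> in M. (\<lambda>t. gradf (x t \<omega>)) \<longlonglongrightarrow> 0))"
proof -
  interpret prob_space M by (rule M)
  \<comment> \<open>One verification serves both methods, since \<kappa> and the initial pair are
    left open. \<open>\<bar>L\<bar> + 1\<close> is a Lipschitz constant that is certainly
    positive.\<close>
  have psgd: "perturbed_sgd M S \<xi> \<xi>s f gradf (\<bar>L\<bar> + 1) G A B C (\<lambda>n. \<alpha> (Suc n)) \<beta> (1 / (1 - \<beta>))"
  proof unfold_locales
    show "\<xi> \<in> measurable M S"
      using unbiased by (simp add: unbiased_stochastic_gradient_def)
    have "L \<le> \<bar>L\<bar> + 1" by linarith
    then show "norm (gradf x - gradf y) \<le> (\<bar>L\<bar> + 1) * norm (x - y)" for x y
      using smooth[of x y] mult_right_mono[of L "\<bar>L\<bar> + 1" "norm (x - y)"] by simp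
    then have smooth_bounded: "smooth_bounded f gradf (\<bar>L\<bar> + 1)"
      using grad bdd by (intro smooth_bounded.intro) auto
    show "(\<integral>\<omega>. (norm (G x (\<xi> \<omega>)))\<^sup>2 \<partial>M)
        \<le> A * smooth_bounded.gap f x + B * (norm (gradf x))\<^sup>2 + C" for x
      using ABC[of x] by (simp add: smooth_bounded.gap_def[OF smooth_bounded])
    show "\<not> summable (\<lambda>n. \<alpha> (Suc n))"
      by (rule not_summable_of_partial_sums_at_top[OF alpha_sum])
    show "iid_copies M S \<xi> {1..} \<xi>s"
      by (rule iid)
    show "0 < \<alpha> (Suc n)" for n
      by (rule alpha_pos) simp
    show "summable (\<lambda>n. (\<alpha> (Suc n))\<^sup>2)"
      using alpha_sq by simp
  qed (use beta in \<open>simp_all add: grad bdd unbiased ABC_nonneg second_moment_integrable\<close>)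
  show ?thesis
  proof (intro conjI allI impI)
    fix a\<^sub>0 a\<^sub>1 :: "real ^ 'd" and x
    assume shb: "SHB M G \<xi>s \<alpha> \<beta> a\<^sub>0 a\<^sub>1 x"
    \<comment> \<open>\<open>c\<close> solves \<open>c = \<beta> * c + \<beta>\<close>, which
      removes the momentum from the recursion for \<open>z\<close> and leaves a pure gradient
      step.\<close>
    define c where "c = \<beta> / (1 - \<beta>)"
    define z\<^sub>0 where "z\<^sub>0 = a\<^sub>1 + c *\<^sub>R (a\<^sub>1 - a\<^sub>0)"
    define u\<^sub>0 where "u\<^sub>0 = - (c *\<^sub>R (a\<^sub>1 - a\<^sub>0))"
    interpret P: perturbed_sgd M S \<xi> \<xi>s f gradf "\<bar>L\<bar> + 1" G A B C "\<lambda>n. \<alpha> (Suc n)" \<beta> "1 / (1 - \<beta>)"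
      c z\<^sub>0 u\<^sub>0
      by (rule psgd)
    have c: "c = \<beta> * c + \<beta>" "1 / (1 - \<beta>) = 1 + c"
      using beta by (simp_all add: c_def field_simps)
    have iterates: "P.u n \<omega> = - (c *\<^sub>R (x (Suc n) \<omega> - x n \<omega>)) \<and> P.x n \<omega> = x (Suc n) \<omega>"
      if "\<omega> \<in> space M" for n \<omega>
    proof (induction n)
      case 0
      have "P.u 0 \<omega> = u\<^sub>0" "P.x 0 \<omega> = z\<^sub>0 + u\<^sub>0"
        by (simp_all add: P.x_def P.z_simps(1) P.u_simps(1))
      moreover have "z\<^sub>0 + u\<^sub>0 = a\<^sub>1"
        by (simp add: z\<^sub>0_def u\<^sub>0_def)
      ultimately show ?case
        using shb that u\<^sub>0_def by (simp add: SHB_def)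
    next
      case (Suc n)
      define \<Delta> where "\<Delta> = x (Suc n) \<omega> - x n \<omega>"
      define h where "h = \<alpha> (Suc n) *\<^sub>R P.g n \<omega>"
      have x: "x (Suc (Suc n)) \<omega> = x (Suc n) \<omega> - h + \<beta> *\<^sub>R \<Delta>"
        using shb that Suc by (simp add: SHB_def P.g_def h_def \<Delta>_def)
      have u: "P.u n \<omega> = - (c *\<^sub>R \<Delta>)"
        using Suc by (simp add: \<Delta>_def)
      have u': "P.u (Suc n) \<omega> = c *\<^sub>R h - (\<beta> * c) *\<^sub>R \<Delta>"
        by (simp add: P.u_simps(2) u h_def)
      have "P.z (Suc n) \<omega> = P.z n \<omega> - (1 + c) *\<^sub>R h"
        by (simp add: P.z_simps(2) c(2)[symmetric] h_def)
      also have "P.z n \<omega> = P.x n \<omega> - P.u n \<omega>"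
        by (simp add: P.x_def)
      \<comment> \<open>In the form \<open>\<beta> * c + \<beta>\<close>, the first part of the
        coefficient cancels against the new offset and the second is the momentum.\<close>
      also have "\<dots> = x (Suc n) \<omega> + (\<beta> * c + \<beta>) *\<^sub>R \<Delta>"
        by (simp only: conjunct2[OF Suc] u c(1)[symmetric]) simp
      finally have "P.x (Suc n) \<omega> = x (Suc (Suc n)) \<omega>"
        by (simp add: P.x_def[of "Suc n"] u' x algebra_simps)
      then show ?case
        by (simp add: u' x algebra_simps)
    qed
    have "AE \<omega> in M. (\<lambda>n. gradf (x (Suc n) \<omega>)) \<longlonglongrightarrow> 0"
      using P.AE_tendsto_grad AE_space by eventually_elim (simp add: iterates)
    then show "AE \<omega> in M. (\<lambda>t. gradf (x t \<omega>)) \<longlonglongrightarrow> 0"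
      by eventually_elim (rule LIMSEQ_imp_Suc)
  next
    fix a\<^sub>1 b\<^sub>1 :: "real ^ 'd" and x y
    assume snag: "SNAG M G \<xi>s \<alpha> \<beta> a\<^sub>1 b\<^sub>1 x y"
    define c where "c = \<beta> / (1 - \<beta>)"
    define z\<^sub>0 where "z\<^sub>0 = a\<^sub>1 + c *\<^sub>R (a\<^sub>1 - b\<^sub>1)"
    define u\<^sub>0 where "u\<^sub>0 = - (c *\<^sub>R (a\<^sub>1 - b\<^sub>1))"
    \<comment> \<open>The offset is now \<open>-c\<close> times \<open>x - y\<close>. One step turns
      \<open>x - y\<close> into \<beta> times \<open>\<Delta> - h\<close>, so the gradient enters
      the offset with \<open>\<beta> * c\<close> where heavy ball has \<open>c\<close>.\<close>
    interpret P: perturbed_sgd M S \<xi> \<xi>s f gradf "\<bar>L\<bar> + 1" G A B C "\<lambda>n. \<alpha> (Suc n)" \<beta> "1 / (1 - \<beta>)"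
      "\<beta> * c" z\<^sub>0 u\<^sub>0
      by (rule psgd)
    have c: "c = \<beta> * c + \<beta>" "1 / (1 - \<beta>) = 1 + (\<beta> * c + \<beta>)"
      using beta by (simp_all add: c_def field_simps)
    have iterates: "P.u n \<omega> = - (c *\<^sub>R (x (Suc n) \<omega> - y (Suc n) \<omega>)) \<and> P.x n \<omega> = x (Suc n) \<omega>"
      if "\<omega> \<in> space M" for n \<omega>
    proof (induction n)
      case 0
      have "P.u 0 \<omega> = u\<^sub>0" "P.x 0 \<omega> = z\<^sub>0 + u\<^sub>0"
        by (simp_all add: P.x_def P.z_simps(1) P.u_simps(1))
      moreover have "z\<^sub>0 + u\<^sub>0 = a\<^sub>1"
        by (simp add: z\<^sub>0_def u\<^sub>0_def)
      ultimately show ?case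
        using snag that u\<^sub>0_def by (simp add: SNAG_def)
    next
      case (Suc n)
      define \<Delta> where "\<Delta> = x (Suc n) \<omega> - y (Suc n) \<omega>"
      define h where "h = \<alpha> (Suc n) *\<^sub>R P.g n \<omega>"
      have y: "y (Suc (Suc n)) \<omega> = x (Suc n) \<omega> - h"
        using snag that Suc by (simp add: SNAG_def P.g_def h_def)
      \<comment> \<open>This is the increment of \<open>y\<close> on which the momentum
        acts.\<close>
      then have "\<Delta> - h = y (Suc (Suc n)) \<omega> - y (Suc n) \<omega>"
        by (simp add: \<Delta>_def)
      then have x: "x (Suc (Suc n)) \<omega> = y (Suc (Suc n)) \<omega> + \<beta> *\<^sub>R (\<Delta> - h)"
        using snag that by (simp add: SNAG_def)
      have u: "P.u n \<omega> = - (c *\<^sub>R \<Delta>)"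
        using Suc by (simp add: \<Delta>_def)
      have u': "P.u (Suc n) \<omega> = (\<beta> * c) *\<^sub>R h - (\<beta> * c) *\<^sub>R \<Delta>"
        by (simp add: P.u_simps(2) u h_def)
      have "P.z (Suc n) \<omega> = P.z n \<omega> - (1 + (\<beta> * c + \<beta>)) *\<^sub>R h"
        by (simp add: P.z_simps(2) c(2)[symmetric] h_def)
      also have "P.z n \<omega> = P.x n \<omega> - P.u n \<omega>"
        by (simp add: P.x_def)
      also have "\<dots> = x (Suc n) \<omega> + (\<beta> * c + \<beta>) *\<^sub>R \<Delta>"
        by (simp only: conjunct2[OF Suc] u c(1)[symmetric]) simp
      finally have "P.x (Suc n) \<omega> = x (Suc (Suc n)) \<omega>"
        by (simp add: P.x_def[of "Suc n"] u' x y algebra_simps)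
      then show ?case
        by (simp add: u' x algebra_simps)
    qed
    have "AE \<omega> in M. (\<lambda>n. gradf (x (Suc n) \<omega>)) \<longlonglongrightarrow> 0"
      using P.AE_tendsto_grad AE_space by eventually_elim (simp add: iterates)
    then show "AE \<omega> in M. (\<lambda>t. gradf (x t \<omega>)) \<longlonglongrightarrow> 0"
      by eventually_elim (rule LIMSEQ_imp_Suc)
  qed
qed

end
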